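(* Let $D$ be a non-commutative division ring with center $F$, let $M$ be a non-abelian locally solvable maximal subgroup of $D^*$, and let $A$ be a maximal abelian normal subgroup of $M$. If there exists an element $\alpha\in A\setminus F$ that is algebraic over $F$, then $[D:F]<\infty$.
   Context: $D^*$ is the multiplicative group of $D$; maximal subgroup = proper subgroup maximal among proper subgroups. Locally solvable: every finitely generated subgroup solvable. A maximal abelian normal subgroup is an abelian normal subgroup not properly contained in another abelian normal subgroup. *)

theory Defs
  imports Main "HOL-Algebra.Solvable_Groups"
begin

definition mult_group :: "('a::division_ring) monoid" where
  "mult_group = \<lparr>carrier = - {0}, mult = (*), one = 1\<rparr>"

definition center_of :: "('a::ring_1) set" where
  "center_of = {x. \<forall>y. x * y = y * x}"

definition maximal_subgroup :: "'a set \<Rightarrow> ('a, 'b) monoid_scheme \<Rightarrow> bool" where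
  "maximal_subgroup M G \<longleftrightarrow> subgroup M G \<and> M \<noteq> carrier G \<and>
     (\<forall>H. subgroup H G \<and> M \<subseteq> H \<and> H \<noteq> carrier G \<longrightarrow> H = M)"

definition locally_solvable :: "('a, 'b) monoid_scheme \<Rightarrow> bool" where
  "locally_solvable G \<longleftrightarrow>
     (\<forall>S. finite S \<and> S \<subseteq> carrier G \<longrightarrow> solvable (subgroup_generated G S))"

definition abelian_set :: "('a, 'b) monoid_scheme \<Rightarrow> 'a set \<Rightarrow> bool" where
  "abelian_set G A \<longleftrightarrow> (\<forall>x\<in>A. \<forall>y\<in>A. x \<otimes>\<^bsub>G\<^esub> y = y \<otimes>\<^bsub>G\<^esub> x)"

definition maximal_abelian_normal :: "'a set \<Rightarrow> ('a, 'b) monoid_scheme \<Rightarrow> bool" where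
  "maximal_abelian_normal A G \<longleftrightarrow> A \<lhd> G \<and> abelian_set G A \<and>
     (\<forall>B. B \<lhd> G \<and> abelian_set G B \<and> A \<subseteq> B \<longrightarrow> B = A)"

text \<open>alpha is a root of a nonzero polynomial with coefficients in F (F central, so
  the evaluation is unambiguous).\<close>
definition algebraic_over :: "('a::ring_1) set \<Rightarrow> 'a \<Rightarrow> bool" where
  "algebraic_over F \<alpha> \<longleftrightarrow> (\<exists>(n::nat) c. (\<forall>i\<le>n. c i \<in> F) \<and> (\<exists>i\<le>n. c i \<noteq> 0) \<and>
     (\<Sum>i\<le>n. c i * \<alpha> ^ i) = 0)"

definition finite_dim_over :: "('a::ring_1) set \<Rightarrow> bool" where
  "finite_dim_over F \<longleftrightarrow> (\<exists>B. finite B \<and>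
     (\<forall>x. \<exists>c. (\<forall>b\<in>B. c b \<in> F) \<and> x = (\<Sum>b\<in>B. c b * b)))"

end

theory Submission
  imports Defs
begin

text \<open>
  Let \<open>X\<close> be the set of conjugates of \<open>\<alpha>\<close> under \<open>M\<close>. It lies in the abelian group \<open>A\<close> and consists of
  roots of one polynomial over the center \<open>F\<close>, so it is finite. Its centralizer \<open>E\<close> is normalised
  by \<open>M\<close>, and the Cartan--Brauer--Hua theorem with the maximality of \<open>M\<close> forces \<open>E - {0} \<subseteq> M\<close>. Hence the
  multiplicative group of \<open>E\<close> is locally solvable, and \<open>E\<close> is a field by the theorem of Zalesskii that a
  division ring with locally solvable multiplicative group is commutative. Centralizing the finitely
  many elements of \<open>X\<close> one after the other shows that \<open>D\<close> has finite left dimension over \<open>E\<close>, and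
  since \<open>E\<close> is a subfield, its dimension over \<open>F\<close> is at most the dimension of \<open>D\<close> over \<open>E\<close>.

  The commutativity of \<open>E\<close> is obtained as follows. For non-commuting \<open>a\<close>, \<open>h\<close> and a finite set \<open>T\<close>
  containing \<open>a\<close>, \<open>h\<close>, \<open>a + h\<close> and their successors, let \<open>B\<close> be the last term of the derived series
  of the group generated by \<open>T\<close> that does not centralize \<open>{a, h}\<close>. The Cartan--Brauer--Hua
  computation shows that \<open>B\<close> and \<open>{a, h}\<close> have the same centralizer, so \<open>B\<close> is nilpotent of class
  exactly two and its elements are linearly independent modulo its central scalars \<open>Z\<close>. This
  independence bounds \<open>B\<close> modulo \<open>Z\<close> by an absolute constant, so all elements of \<open>T\<close> have a central
  power of bounded exponent. Replacing \<open>a\<close>, \<open>h\<close> by elements of \<open>B\<close> one may assume \<open>h a = l a h\<close> with a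
  central scalar \<open>l\<close>. If there are infinitely many central scalars \<open>z\<close>, then
  \<open>(l a + z)\<^sup>N = (a + z)\<^sup>N\<close> for too many \<open>z\<close>; if there are finitely many, then \<open>a\<close> and \<open>h\<close> generate a
  finite division ring, to which Hua's argument for solvable multiplicative groups applies.
\<close>

subsection \<open>Division subrings and centralizers\<close>

definition commutant :: "'a::ring_1 set \<Rightarrow> 'a set" where
  "commutant X = {y. \<forall>x\<in>X. x * y = y * x}"

definition division_subring :: "'a::division_ring set \<Rightarrow> bool" where
  "division_subring K \<longleftrightarrow> 0 \<in> K \<and> 1 \<in> K \<and>
     (\<forall>x\<in>K. \<forall>y\<in>K. x + y \<in> K \<and> x * y \<in> K) \<and> (\<forall>x\<in>K. - x \<in> K \<and> inverse x \<in> K)"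

lemma division_subringD:
  assumes "division_subring K"
  shows "0 \<in> K" "1 \<in> K" "\<And>x y. x \<in> K \<Longrightarrow> y \<in> K \<Longrightarrow> x + y \<in> K"
    "\<And>x y. x \<in> K \<Longrightarrow> y \<in> K \<Longrightarrow> x * y \<in> K" "\<And>x. x \<in> K \<Longrightarrow> - x \<in> K"
    "\<And>x. x \<in> K \<Longrightarrow> inverse x \<in> K" "\<And>x y. x \<in> K \<Longrightarrow> y \<in> K \<Longrightarrow> x - y \<in> K"
    "\<And>x n. x \<in> K \<Longrightarrow> x ^ n \<in> K"
proof -
  show *: "0 \<in> K" "1 \<in> K" "\<And>x y. x \<in> K \<Longrightarrow> y \<in> K \<Longrightarrow> x + y \<in> K"
    "\<And>x y. x \<in> K \<Longrightarrow> y \<in> K \<Longrightarrow> x * y \<in> K" "\<And>x. x \<in> K \<Longrightarrow> - x \<in> K"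
    "\<And>x. x \<in> K \<Longrightarrow> inverse x \<in> K"
    using assms by (auto simp: division_subring_def)
  show "x - y \<in> K" if "x \<in> K" "y \<in> K" for x y
    using *(3)[of x "- y"] *(5) that by simp
  show "x ^ n \<in> K" if "x \<in> K" for x n
    using that * by (induction n) auto
qed

lemma division_subring_sum:
  assumes "division_subring K" "\<And>i. i \<in> I \<Longrightarrow> f i \<in> K"
  shows "sum f I \<in> K"
  using assms(2) by (induction I rule: infinite_finite_induct) (auto intro: division_subringD[OF assms(1)])

lemma division_subring_Int:
  "division_subring K \<Longrightarrow> division_subring L \<Longrightarrow> division_subring (K \<inter> L)"
  by (auto simp: division_subring_def)

lemma commutant_iff: "y \<in> commutant X \<longleftrightarrow> (\<forall>x\<in>X. x * y = y * x)"
  by (simp add: commutant_def)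

lemma commutantD: "y \<in> commutant X \<Longrightarrow> x \<in> X \<Longrightarrow> x * y = y * x"
  by (simp add: commutant_def)

lemma commutant_antimono: "X \<subseteq> Y \<Longrightarrow> commutant Y \<subseteq> commutant X"
  by (auto simp: commutant_def)

lemma subset_commutant_commutant: "X \<subseteq> commutant (commutant X)"
  by (auto simp: commutant_def)

lemma center_of_eq_commutant: "center_of = commutant UNIV"
  by (auto simp: center_of_def commutant_def)

lemma division_subring_commutant: "division_subring (commutant (X :: 'a::division_ring set))"
proof -
  have "z * (x * y) = x * y * z" if "z * x = x * z" "z * y = y * z" for x y z :: 'a
    using that by (metis mult.assoc)
  moreover have "z * inverse x = inverse x * z" if "z * x = x * z" for x z :: 'a
    using mult_commute_imp_mult_inverse_commute[of x z] that by metis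
  ultimately show ?thesis
    by (auto simp: division_subring_def commutant_iff distrib_left distrib_right)
qed

lemma commuting_power: "x * y = y * (x::'a::monoid_mult) \<Longrightarrow> x ^ n * y = y * x ^ n"
  by (induction n) (auto simp: mult.assoc, metis mult.assoc)

subsection \<open>Commuting roots\<close>

text \<open>Horner's scheme: if \<open>p(X) = c 0 + p'(X) X\<close> and
  \<open>p'(X) = \<gamma> + d(X) (X - r)\<close>, then
  \<open>p(s) - p(r) = (\<gamma> + d(s) s) (s - r)\<close>, because \<open>s\<close> commutes with
  \<open>r\<close>. The clause on \<open>d n\<close> says that the quotient keeps the leading
  coefficient, which a degree argument needs.\<close>

lemma right_division_by_linear_factor:
  fixes c :: "nat \<Rightarrow> 'a::division_ring"
  assumes "r \<in> S" and comm: "\<And>s t. s \<in> S \<Longrightarrow> t \<in> S \<Longrightarrow> s * t = t * s"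
    and "\<And>i. c i \<in> commutant S"
  shows "\<exists>d. (\<forall>i. d i \<in> commutant S) \<and> d n = c (Suc n) \<and>
    (\<forall>s\<in>S. (\<Sum>i\<le>Suc n. c i * s ^ i) - (\<Sum>i\<le>Suc n. c i * r ^ i) = (\<Sum>i\<le>n. d i * s ^ i) * (s - r))"
  using assms(3)
proof (induction n arbitrary: c)
  case 0
  then show ?case by (intro exI[of _ "\<lambda>_. c 1"]) (auto simp: algebra_simps)
next
  case (Suc n)
  obtain d where d: "\<And>i. d i \<in> commutant S" "d n = c (Suc (Suc n))"
    and eq: "\<And>s. s \<in> S \<Longrightarrow> (\<Sum>i\<le>Suc n. c (Suc i) * s ^ i) - (\<Sum>i\<le>Suc n. c (Suc i) * r ^ i)
        = (\<Sum>i\<le>n. d i * s ^ i) * (s - r)"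
    using Suc.IH[of "\<lambda>i. c (Suc i)"] Suc.prems by auto
  define \<gamma> where "\<gamma> = (\<Sum>i\<le>Suc n. c (Suc i) * r ^ i)"
  have split: "(\<Sum>i\<le>Suc (Suc n). e i * s ^ i) = e 0 + (\<Sum>i\<le>Suc n. e (Suc i) * s ^ i) * s"
    "(\<Sum>i\<le>Suc n. e i * s ^ i) = e 0 + (\<Sum>i\<le>n. e (Suc i) * s ^ i) * s" for s and e :: "nat \<Rightarrow> 'a"
    by (simp_all only: sum.atMost_Suc_shift[of "\<lambda>i. e i * s ^ i" "Suc n"]
        sum.atMost_Suc_shift[of "\<lambda>i. e i * s ^ i" "n"]
        sum_distrib_right power_Suc2 mult.assoc power_0 mult_1_right)
  have r: "r \<in> commutant S" using comm \<open>r \<in> S\<close> by (auto simp: commutant_iff)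
  have \<gamma>: "\<gamma> \<in> commutant S"
    unfolding \<gamma>_def
    by (intro division_subring_sum[OF division_subring_commutant]
        division_subringD[OF division_subring_commutant] Suc.prems r)
  define e where "e = (\<lambda>i. case i of 0 \<Rightarrow> \<gamma> | Suc j \<Rightarrow> d j)"
  have "(\<Sum>i\<le>Suc (Suc n). c i * s ^ i) - (\<Sum>i\<le>Suc (Suc n). c i * r ^ i)
      = (\<Sum>i\<le>Suc n. e i * s ^ i) * (s - r)" if s: "s \<in> S" for s
  proof -
    have "(\<Sum>i\<le>Suc n. c (Suc i) * s ^ i) = \<gamma> + (\<Sum>i\<le>n. d i * s ^ i) * (s - r)"
      using eq[OF s] by (simp add: \<gamma>_def algebra_simps)
    then have "(\<Sum>i\<le>Suc (Suc n). c i * s ^ i) - (\<Sum>i\<le>Suc (Suc n). c i * r ^ i)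
        = (\<gamma> + (\<Sum>i\<le>n. d i * s ^ i) * (s - r)) * s - \<gamma> * r"
      unfolding split(1) \<gamma>_def by simp
    also have "\<dots> = (\<gamma> + (\<Sum>i\<le>n. d i * s ^ i) * s) * (s - r)"
      using comm[OF s \<open>r \<in> S\<close>] by (simp add: algebra_simps)
    also have "\<gamma> + (\<Sum>i\<le>n. d i * s ^ i) * s = (\<Sum>i\<le>Suc n. e i * s ^ i)"
      unfolding split(2) by (simp add: e_def)
    finally show ?thesis .
  qed
  moreover have "\<forall>i. e i \<in> commutant S" "e (Suc n) = c (Suc (Suc n))"
    using d \<gamma> by (auto simp: e_def split: nat.split)
  ultimately show ?case by blast
qed

text \<open>Each root splits off a linear factor, and without zero divisors every other root is a
  root of the quotient. Commutativity of \<open>S\<close> is essential: over the quaternions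
  \<open>X^2 + 1\<close> has infinitely many roots.\<close>

lemma commuting_roots_finite:
  fixes c :: "nat \<Rightarrow> 'a::division_ring"
  assumes "\<And>s t. s \<in> S \<Longrightarrow> t \<in> S \<Longrightarrow> s * t = t * s" and "\<And>i. c i \<in> commutant S"
    and "c n \<noteq> 0" and "\<And>s. s \<in> S \<Longrightarrow> (\<Sum>i\<le>n. c i * s ^ i) = 0"
  shows "finite S \<and> card S \<le> n"
  using assms
proof (induction n arbitrary: S c)
  case 0
  then have "S = {}" by auto
  then show ?case by simp
next
  case (Suc n)
  show ?case
  proof (cases "S = {}")
    case False
    then obtain r where r: "r \<in> S" by blast
    obtain d where d: "\<And>i. d i \<in> commutant S" "d n = c (Suc n)"
      and eq: "\<And>s. s \<in> S \<Longrightarrow> (\<Sum>i\<le>Suc n. c i * s ^ i) - (\<Sum>i\<le>Suc n. c i * r ^ i)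
        = (\<Sum>i\<le>n. d i * s ^ i) * (s - r)"
      using right_division_by_linear_factor[of r S c n, OF r Suc.prems(1)] Suc.prems(2) by blast
    have "finite (S - {r}) \<and> card (S - {r}) \<le> n"
    proof (rule Suc.IH[of "S - {r}" d])
      show "(\<Sum>i\<le>n. d i * s ^ i) = 0" if "s \<in> S - {r}" for s
        using eq[of s] Suc.prems(4)[of s] Suc.prems(4)[of r] r that by auto
      show "d i \<in> commutant (S - {r})" for i
        using d commutant_antimono[of "S - {r}" S] by blast
    qed (use Suc.prems d in auto)
    then show ?thesis using r by (auto simp: card_Diff_singleton)
  qed simp
qed

subsection \<open>Linear systems over a division ring\<close>

text \<open>Gaussian elimination: equation \<open>k\<close> is solved for the unknown
  \<open>j0\<close> and substituted into the others. All operations stay in \<open>K\<close>, so the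
  solution does too.\<close>

lemma left_linear_system:
  fixes A :: "'i \<Rightarrow> 'j \<Rightarrow> 'a::division_ring"
  assumes K: "division_subring K" and "finite I"
  shows "\<And>A J. \<lbrakk>finite J; card I < card J; \<And>i j. i \<in> I \<Longrightarrow> j \<in> J \<Longrightarrow> A i j \<in> K\<rbrakk> \<Longrightarrow>
    \<exists>c. (\<forall>j\<in>J. c j \<in> K) \<and> (\<exists>j\<in>J. c j \<noteq> 0) \<and> (\<forall>i\<in>I. (\<Sum>j\<in>J. c j * A i j) = 0)"
  using assms(2)
proof (induction I rule: finite_induct)
  case empty
  then have "J \<noteq> {}" by auto
  then show ?case
    by (intro exI[of _ "\<lambda>_. 1"]) (auto intro: division_subringD[OF K])
next
  case (insert k I)
  show ?case
  proof (cases "\<forall>j\<in>J. A k j = 0")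
    case True
    obtain c where "\<forall>j\<in>J. c j \<in> K" "\<exists>j\<in>J. c j \<noteq> 0" "\<forall>i\<in>I. (\<Sum>j\<in>J. c j * A i j) = 0"
      using insert.IH[of J A] insert.prems insert.hyps by auto
    with True show ?thesis by (intro exI[of _ c]) auto
  next
    case False
    then obtain j0 where j0: "j0 \<in> J" "A k j0 \<noteq> 0" by blast
    define J' where "J' = J - {j0}"
    have J': "finite J'" "J = insert j0 J'" "j0 \<notin> J'"
      using insert.prems j0 by (auto simp: J'_def)
    define A' where "A' = (\<lambda>i j. A i j - A k j * inverse (A k j0) * A i j0)"
    have AK: "A i j \<in> K" if "i \<in> insert k I" "j \<in> J" for i j
      using insert.prems that by blast
    have "\<exists>c. (\<forall>j\<in>J'. c j \<in> K) \<and> (\<exists>j\<in>J'. c j \<noteq> 0) \<and> (\<forall>i\<in>I. (\<Sum>j\<in>J'. c j * A' i j) = 0)"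
    proof (rule insert.IH)
      show "card I < card J'" using insert.prems insert.hyps j0 by (simp add: J'_def)
      show "A' i j \<in> K" if "i \<in> I" "j \<in> J'" for i j
        unfolding A'_def using that j0 J' by (intro division_subringD[OF K] AK) auto
    qed fact
    then obtain c where c: "\<And>j. j \<in> J' \<Longrightarrow> c j \<in> K" "\<exists>j\<in>J'. c j \<noteq> 0"
      "\<And>i. i \<in> I \<Longrightarrow> (\<Sum>j\<in>J'. c j * A' i j) = 0" by blast
    define s where "s = (\<Sum>j\<in>J'. c j * A k j)"
    define c' where "c' = c (j0 := - (s * inverse (A k j0)))"
    have eq: "(\<Sum>j\<in>J. c' j * A i j) = (\<Sum>j\<in>J'. c j * A i j) - s * inverse (A k j0) * A i j0" for i
    proof -
      have "(\<Sum>j\<in>J'. c' j * A i j) = (\<Sum>j\<in>J'. c j * A i j)"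
        using J' by (intro sum.cong) (auto simp: c'_def)
      then show ?thesis using J' by (simp add: c'_def)
    qed
    show ?thesis
    proof (intro exI[of _ c'] conjI ballI)
      fix j assume "j \<in> J"
      moreover have "s \<in> K" unfolding s_def
        using J' c AK by (intro division_subring_sum[OF K] division_subringD[OF K]) auto
      ultimately show "c' j \<in> K"
        using c J' j0 AK unfolding c'_def by (auto intro!: division_subringD[OF K])
    next
      show "\<exists>j\<in>J. c' j \<noteq> 0" using c J' by (auto simp: c'_def)
    next
      fix i assume i: "i \<in> insert k I"
      show "(\<Sum>j\<in>J. c' j * A i j) = 0"
      proof (cases "i = k")
        case True
        then show ?thesis unfolding eq using j0 by (simp add: s_def mult.assoc)
      next
        case False
        have "(\<Sum>j\<in>J'. c j * A i j) - s * inverse (A k j0) * A i j0 = (\<Sum>j\<in>J'. c j * A' i j)"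
          by (simp add: A'_def s_def right_diff_distrib sum_subtractf sum_distrib_right mult.assoc)
        then show ?thesis using eq c False i by auto
      qed
    qed
  qed
qed

lemma right_linear_system:
  fixes A :: "'i \<Rightarrow> 'j \<Rightarrow> 'a::division_ring"
  assumes "finite I"
  shows "\<And>A J. \<lbrakk>finite J; card I < card J\<rbrakk> \<Longrightarrow>
    \<exists>c::'j \<Rightarrow> 'a. (\<exists>j\<in>J. c j \<noteq> 0) \<and> (\<forall>i\<in>I. (\<Sum>j\<in>J. A i j * c j) = 0)"
  using assms
proof (induction I rule: finite_induct)
  case empty
  then have "J \<noteq> {}" by auto
  then show ?case by (intro exI[of _ "\<lambda>_. 1"]) auto
next
  case (insert k I)
  show ?case
  proof (cases "\<forall>j\<in>J. A k j = 0")
    case True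
    obtain c :: "'j \<Rightarrow> 'a" where "\<exists>j\<in>J. c j \<noteq> 0" "\<forall>i\<in>I. (\<Sum>j\<in>J. A i j * c j) = 0"
      using insert.IH[of J A] insert.prems insert.hyps by auto
    with True show ?thesis by (intro exI[of _ c]) auto
  next
    case False
    then obtain j0 where j0: "j0 \<in> J" "A k j0 \<noteq> 0" by blast
    define J' where "J' = J - {j0}"
    have J': "finite J'" "J = insert j0 J'" "j0 \<notin> J'"
      using insert.prems j0 by (auto simp: J'_def)
    define A' where "A' = (\<lambda>i j. A i j - A i j0 * inverse (A k j0) * A k j)"
    have "card I < card J'" using insert.prems insert.hyps j0 by (simp add: J'_def)
    then obtain c :: "'j \<Rightarrow> 'a" where c: "\<exists>j\<in>J'. c j \<noteq> 0"
      "\<And>i. i \<in> I \<Longrightarrow> (\<Sum>j\<in>J'. A' i j * c j) = 0" using insert.IH[of J' A'] J' by blast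
    define s where "s = (\<Sum>j\<in>J'. A k j * c j)"
    define c' where "c' = c (j0 := - (inverse (A k j0) * s))"
    have eq: "(\<Sum>j\<in>J. A i j * c' j) = (\<Sum>j\<in>J'. A i j * c j) - A i j0 * inverse (A k j0) * s" for i
    proof -
      have "(\<Sum>j\<in>J'. A i j * c' j) = (\<Sum>j\<in>J'. A i j * c j)"
        using J' by (intro sum.cong) (auto simp: c'_def)
      then show ?thesis using J' by (simp add: c'_def mult.assoc)
    qed
    show ?thesis
    proof (intro exI[of _ c'] conjI ballI)
      show "\<exists>j\<in>J. c' j \<noteq> 0" using c J' by (auto simp: c'_def)
    next
      fix i assume i: "i \<in> insert k I"
      show "(\<Sum>j\<in>J. A i j * c' j) = 0"
      proof (cases "i = k")
        case True
        then show ?thesis unfolding eq using j0 by (simp add: s_def)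
      next
        case False
        have "(\<Sum>j\<in>J'. A i j * c j) - A i j0 * inverse (A k j0) * s = (\<Sum>j\<in>J'. A' i j * c j)"
          by (simp add: A'_def s_def left_diff_distrib sum_subtractf sum_distrib_left mult.assoc)
        then show ?thesis using eq c False i by auto
      qed
    qed
  qed
qed

text \<open>Used twice in the same way: a solution of minimal support is scaled to have a
  coefficient 1; its commutators with a fixed element then form a solution of smaller support, which
  vanishes, so the coefficients commute with that element.\<close>

lemma minimal_support:
  fixes P :: "('i \<Rightarrow> 'a::zero) \<Rightarrow> bool"
  assumes "P c" "\<exists>j\<in>J. c j \<noteq> 0" "finite J"
  obtains d where "P d" "\<exists>j\<in>J. d j \<noteq> 0"
    "\<And>e k. P e \<Longrightarrow> (\<And>j. j \<in> J \<Longrightarrow> d j = 0 \<Longrightarrow> e j = 0) \<Longrightarrow> k \<in> J \<Longrightarrow> d k \<noteq> 0 \<Longrightarrow> e k = 0 \<Longrightarrow> \<forall>j\<in>J. e j = 0"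
proof -
  define supp where "supp c = {j\<in>J. c j \<noteq> 0}" for c :: "'i \<Rightarrow> 'a"
  obtain d where d: "P d" "\<exists>j\<in>J. d j \<noteq> 0"
    and min: "\<And>e. P e \<and> (\<exists>j\<in>J. e j \<noteq> 0) \<Longrightarrow> card (supp d) \<le> card (supp e)"
    using ex_has_least_nat[of "\<lambda>c. P c \<and> (\<exists>j\<in>J. c j \<noteq> 0)" c "\<lambda>c. card (supp c)"] assms by blast
  show ?thesis
  proof (rule that[OF d])
    fix e k assume e: "P e" "\<And>j. j \<in> J \<Longrightarrow> d j = 0 \<Longrightarrow> e j = 0" "k \<in> J" "d k \<noteq> 0" "e k = 0"
    then have "supp e \<subset> supp d" by (auto simp: supp_def)
    moreover have "finite (supp d)" using \<open>finite J\<close> by (simp add: supp_def)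
    ultimately have "card (supp e) < card (supp d)" by (rule psubset_card_mono[rotated])
    then show "\<forall>j\<in>J. e j = 0" using min[of e] e(1) by auto
  qed
qed

subsection \<open>Finite left dimension\<close>

definition finitely_spanned :: "'a::division_ring set \<Rightarrow> 'a set \<Rightarrow> bool" where
  "finitely_spanned K V \<longleftrightarrow> (\<exists>B. finite B \<and> B \<subseteq> V \<and>
     (\<forall>x\<in>V. \<exists>c. (\<forall>b\<in>B. c b \<in> K) \<and> x = (\<Sum>b\<in>B. c b * b)))"

text \<open>The bound \<open>n\<close> guarantees an independent subset of largest size, and such a
  subset spans.\<close>

lemma finitely_spannedI:
  assumes K: "division_subring K"
    and dep: "\<And>J. finite J \<Longrightarrow> J \<subseteq> V \<Longrightarrow> n < card J \<Longrightarrow>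
      \<exists>c. (\<forall>b\<in>J. c b \<in> K) \<and> (\<exists>b\<in>J. c b \<noteq> 0) \<and> (\<Sum>b\<in>J. c b * b) = 0"
  shows "finitely_spanned K V"
proof -
  define indep where "indep J \<longleftrightarrow> finite J \<and> J \<subseteq> V \<and>
    (\<forall>c. (\<forall>b\<in>J. c b \<in> K) \<and> (\<Sum>b\<in>J. c b * b) = 0 \<longrightarrow> (\<forall>b\<in>J. c b = 0))" for J
  have "indep {}" by (simp add: indep_def)
  moreover have "card J \<le> n" if J: "indep J" for J
  proof (rule ccontr)
    assume "\<not> card J \<le> n"
    then obtain c where "\<forall>b\<in>J. c b \<in> K" "\<exists>b\<in>J. c b \<noteq> 0" "(\<Sum>b\<in>J. c b * b) = 0"
      using dep[of J] J unfolding indep_def by (metis not_le)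
    then show False using J unfolding indep_def by blast
  qed
  ultimately obtain J where J: "indep J" and max: "\<And>J'. indep J' \<Longrightarrow> card J' \<le> card J"
    using ex_has_greatest_nat[of indep "{}" card "Suc n"] by (auto simp: less_Suc_eq_le)
  show ?thesis
    unfolding finitely_spanned_def
  proof (intro exI[of _ J] conjI ballI)
    show "finite J" "J \<subseteq> V" using J by (auto simp: indep_def)
    fix x assume x: "x \<in> V"
    show "\<exists>c. (\<forall>b\<in>J. c b \<in> K) \<and> x = (\<Sum>b\<in>J. c b * b)"
    proof (cases "x \<in> J")
      case True
      have "(\<Sum>b\<in>J. (if b = x then 1 else 0) * b) = (\<Sum>b\<in>J. if b = x then b else 0)"
        by (intro sum.cong) auto
      also have "\<dots> = x" using True \<open>finite J\<close> by simp
      finally show ?thesis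
        by (intro exI[of _ "\<lambda>b. if b = x then 1 else 0"]) (auto intro: division_subringD[OF K])
    next
      case False
      have "\<not> indep (insert x J)" using max[of "insert x J"] False \<open>finite J\<close> by auto
      moreover have "finite (insert x J)" "insert x J \<subseteq> V" using x J by (auto simp: indep_def)
      ultimately obtain c where c: "\<And>b. b \<in> insert x J \<Longrightarrow> c b \<in> K"
        "(\<Sum>b\<in>insert x J. c b * b) = 0" "\<exists>b\<in>insert x J. c b \<noteq> 0"
        unfolding indep_def by blast
      have sum: "c x * x + (\<Sum>b\<in>J. c b * b) = 0" using c False \<open>finite J\<close> by simp
      have cx: "c x \<noteq> 0"
      proof
        assume 0: "c x = 0"
        then have "(\<Sum>b\<in>J. c b * b) = 0" using sum by simp
        then have "\<forall>b\<in>J. c b = 0" using J c(1) by (simp add: indep_def)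
        then show False using c(3) 0 by auto
      qed
      have "x = inverse (c x) * (c x * x)" using cx by (simp add: mult.assoc[symmetric])
      also have "c x * x = - (\<Sum>b\<in>J. c b * b)" using sum by (simp add: add_eq_0_iff2)
      also have "inverse (c x) * \<dots> = (\<Sum>b\<in>J. (- inverse (c x) * c b) * b)"
        by (simp add: sum_distrib_left sum_negf mult.assoc)
      finally show ?thesis
        using c(1) by (intro exI[of _ "\<lambda>b. - inverse (c x) * c b"])
          (auto intro!: division_subringD[OF K])
    qed
  qed
qed

lemma finitely_spanned_trans:
  assumes L: "division_subring L" "L \<subseteq> K" and "K \<subseteq> V" "\<And>x y. x \<in> K \<Longrightarrow> y \<in> V \<Longrightarrow> x * y \<in> V"
    and KL: "finitely_spanned L K" and VK: "finitely_spanned K V"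
  shows "finitely_spanned L V"
proof -
  obtain C where C: "finite C" "C \<subseteq> K" "\<And>x. x \<in> K \<Longrightarrow> \<exists>c. (\<forall>b\<in>C. c b \<in> L) \<and> x = (\<Sum>b\<in>C. c b * b)"
    using KL unfolding finitely_spanned_def by meson
  obtain B where B: "finite B" "B \<subseteq> V" "\<And>x. x \<in> V \<Longrightarrow> \<exists>c. (\<forall>b\<in>B. c b \<in> K) \<and> x = (\<Sum>b\<in>B. c b * b)"
    using VK unfolding finitely_spanned_def by meson
  define g where "g = (\<lambda>(b, c). c * b :: 'a)"
  have fin: "finite (B \<times> C)" using B C by simp
  show ?thesis
    unfolding finitely_spanned_def
  proof (intro exI[of _ "g ` (B \<times> C)"] conjI ballI)
    show "g ` (B \<times> C) \<subseteq> V" using B(2) C(2) by (auto simp: g_def intro!: assms(4))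
    fix x assume "x \<in> V"
    then obtain k where k: "\<And>b. b \<in> B \<Longrightarrow> k b \<in> K" "x = (\<Sum>b\<in>B. k b * b)" using B by meson
    have "\<forall>b. \<exists>l. b \<in> B \<longrightarrow> (\<forall>c\<in>C. l c \<in> L) \<and> k b = (\<Sum>c\<in>C. l c * c)"
      using C k by meson
    then obtain l where l: "\<And>b c. b \<in> B \<Longrightarrow> c \<in> C \<Longrightarrow> l b c \<in> L"
      "\<And>b. b \<in> B \<Longrightarrow> k b = (\<Sum>c\<in>C. l b c * c)" by metis
    have "x = (\<Sum>b\<in>B. (\<Sum>c\<in>C. l b c * c) * b)" unfolding k(2) using l by (intro sum.cong) auto
    also have "\<dots> = (\<Sum>p\<in>B \<times> C. l (fst p) (snd p) * g p)"
      by (simp add: sum_distrib_right mult.assoc sum.cartesian_product g_def case_prod_unfold)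
    \<comment> \<open>The product map \<open>g\<close> need not be injective on
      \<open>B \<times> C\<close>, so the coefficients of all pairs with the same product are added
      up.\<close>
    also have "\<dots> = (\<Sum>y\<in>g ` (B \<times> C). \<Sum>p\<in>{p \<in> B \<times> C. g p = y}. l (fst p) (snd p) * g p)"
      using sum.image_gen[OF fin] .
    also have "\<dots> = (\<Sum>y\<in>g ` (B \<times> C). (\<Sum>p\<in>{p \<in> B \<times> C. g p = y}. l (fst p) (snd p)) * y)"
      by (intro sum.cong refl) (auto simp: sum_distrib_right intro!: sum.cong)
    finally show "\<exists>c. (\<forall>b\<in>g ` (B \<times> C). c b \<in> L) \<and> x = (\<Sum>b\<in>g ` (B \<times> C). c b * b)"
      using l by (intro exI[of _ "\<lambda>y. \<Sum>p\<in>{p \<in> B \<times> C. g p = y}. l (fst p) (snd p)"])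
        (auto intro!: division_subring_sum[OF L(1)])
  qed (use fin in simp)
qed

text \<open>More than \<open>n\<close> elements \<open>j\<close> of \<open>K\<close> are dependent
  over the centralizer of \<open>x\<close>. The relations
  \<open>\<Sum>j. c j * x ^ i * j = 0\<close> are considered for all \<open>i\<close> at once: this
  system is stable under replacing \<open>c j\<close> by \<open>c j * x\<close>, so a scaled
  solution of minimal support commutes with \<open>x\<close>, and row \<open>i = 0\<close> is the
  wanted dependence.\<close>

lemma finitely_spanned_over_commutant:
  fixes x :: "'a::division_ring"
  assumes K: "division_subring K" and x: "x \<in> K"
    and k: "\<And>i. k i \<in> commutant K" "k n \<noteq> 0" and root: "(\<Sum>i\<le>n. k i * x ^ i) = 0"
  shows "finitely_spanned (K \<inter> commutant {x}) K"
proof (rule finitely_spannedI[of _ _ n])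
  show "division_subring (K \<inter> commutant {x})"
    by (intro division_subring_Int K division_subring_commutant)
  fix J assume J: "finite J" "J \<subseteq> K" "n < card J"
  define P where "P c \<longleftrightarrow> (\<forall>j\<in>J. c j \<in> K) \<and> (\<forall>i. (\<Sum>j\<in>J. c j * (x ^ i * j)) = 0)" for c
  have "\<exists>c. (\<forall>j\<in>J. c j \<in> K) \<and> (\<exists>j\<in>J. c j \<noteq> 0) \<and> (\<forall>i\<in>{..<n}. (\<Sum>j\<in>J. c j * (x ^ i * j)) = 0)"
    using J x by (intro left_linear_system[OF K]) (auto intro!: division_subringD[OF K])
  then obtain c where c: "\<forall>j\<in>J. c j \<in> K" "\<exists>j\<in>J. c j \<noteq> 0"
    "\<And>i. i < n \<Longrightarrow> (\<Sum>j\<in>J. c j * (x ^ i * j)) = 0" by auto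
  \<comment> \<open>Only the rows \<open>i < n\<close> were imposed. A later row follows from the
    \<open>n\<close> rows before it through the equation of \<open>x\<close> times
    \<open>x ^ (i - n)\<close>, since the \<open>k l\<close> commute with the
    \<open>c j\<close>.\<close>
  have "(\<Sum>j\<in>J. c j * (x ^ i * j)) = 0" for i
  proof (induction i rule: less_induct)
    case (less i)
    show ?case
    proof (cases "i < n")
      case False
      define f where "f = (\<lambda>i. \<Sum>j\<in>J. c j * (x ^ i * j))"
      have "(\<Sum>l\<le>n. k l * f (l + (i - n))) = (\<Sum>l\<le>n. \<Sum>j\<in>J. c j * (k l * x ^ l) * x ^ (i - n) * j)"
      proof (intro sum.cong refl)
        fix l
        have "k l * c j = c j * k l" if "j \<in> J" for j
          using k(1)[of l] c(1) that by (simp add: commutant_iff)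
        then show "k l * f (l + (i - n)) = (\<Sum>j\<in>J. c j * (k l * x ^ l) * x ^ (i - n) * j)"
          unfolding f_def sum_distrib_left
          by (intro sum.cong refl) (simp add: power_add flip: mult.assoc)
      qed
      also have "\<dots> = (\<Sum>j\<in>J. c j * (\<Sum>l\<le>n. k l * x ^ l) * x ^ (i - n) * j)"
        by (subst sum.swap) (simp add: sum_distrib_left sum_distrib_right)
      finally have "(\<Sum>l\<le>n. k l * f (l + (i - n))) = 0" by (simp add: root)
      moreover have "(\<Sum>l\<le>n. k l * f (l + (i - n))) = k n * f i"
      proof -
        have "f (l + (i - n)) = 0" if "l < n" for l
          unfolding f_def using less[of "l + (i - n)"] that False by auto
        then have "(\<Sum>l<n. k l * f (l + (i - n))) = 0" by simp
        then show ?thesis using False by (simp add: lessThan_Suc_atMost[symmetric])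
      qed
      ultimately have "f i = 0" using k by simp
      then show ?thesis by (simp add: f_def)
    qed (use c in simp)
  qed
  then have "P c" using c by (simp add: P_def)
  then obtain d where d: "P d" "\<exists>j\<in>J. d j \<noteq> 0"
    and min: "\<And>e k. P e \<Longrightarrow> (\<And>j. j \<in> J \<Longrightarrow> d j = 0 \<Longrightarrow> e j = 0) \<Longrightarrow> k \<in> J \<Longrightarrow> d k \<noteq> 0 \<Longrightarrow>
      e k = 0 \<Longrightarrow> \<forall>j\<in>J. e j = 0"
    using minimal_support[of P c J] c J by blast
  from d(2) obtain j0 where j0: "j0 \<in> J" "d j0 \<noteq> 0" by blast
  define e where "e j = inverse (d j0) * d j" for j
  have eK: "e j \<in> K" if "j \<in> J" for j
    using d(1) j0 that by (auto simp: e_def P_def intro!: division_subringD[OF K])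
  have e0: "(\<Sum>j\<in>J. e j * (x ^ i * j)) = 0" for i
  proof -
    have "(\<Sum>j\<in>J. e j * (x ^ i * j)) = inverse (d j0) * (\<Sum>j\<in>J. d j * (x ^ i * j))"
      by (simp add: e_def sum_distrib_left mult.assoc)
    then show ?thesis using d(1) by (simp add: P_def)
  qed
  \<comment> \<open>The commutators solve every row, as their second term turns row \<open>i\<close>
    into row \<open>i + 1\<close>, and they vanish at \<open>j0\<close> because
    \<open>e j0 = 1\<close>.\<close>
  have "\<forall>j\<in>J. x * e j - e j * x = 0"
  proof (rule min[of _ j0])
    have "(\<Sum>j\<in>J. (x * e j - e j * x) * (x ^ i * j)) = 0" for i
    proof -
      have "(\<Sum>j\<in>J. (x * e j - e j * x) * (x ^ i * j))
          = x * (\<Sum>j\<in>J. e j * (x ^ i * j)) - (\<Sum>j\<in>J. e j * (x ^ Suc i * j))"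
        by (simp add: sum_distrib_left left_diff_distrib sum_subtractf mult.assoc)
      then show ?thesis by (simp only: e0) simp
    qed
    then show "P (\<lambda>j. x * e j - e j * x)"
      unfolding P_def using eK x by (auto intro!: division_subringD[OF K])
  qed (use j0 in \<open>auto simp: e_def\<close>)
  moreover have "(\<Sum>j\<in>J. e j * j) = 0" using e0[of 0] by simp
  moreover have "e j0 \<noteq> 0" using j0 by (simp add: e_def)
  ultimately show "\<exists>c. (\<forall>b\<in>J. c b \<in> K \<inter> commutant {x}) \<and> (\<exists>b\<in>J. c b \<noteq> 0) \<and> (\<Sum>b\<in>J. c b * b) = 0"
    using eK j0 by (intro exI[of _ e]) (auto simp: commutant_iff)
qed

text \<open>A basis of \<open>E\<close> longer than one of the whole ring over \<open>E\<close> would give a nontrivial identity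
  \<open>\<Sum>j. j x d\<^sub>j = 0\<close> for all \<open>x\<close>; one of minimal support has central coefficients.\<close>

lemma subfield_finitely_spanned_over_center:
  fixes E :: "'a::division_ring set"
  assumes E: "division_subring E" "\<And>x y. x \<in> E \<Longrightarrow> y \<in> E \<Longrightarrow> x * y = y * x"
    and span: "finitely_spanned E UNIV"
  shows "finitely_spanned center_of E"
proof -
  obtain B where B: "finite B" "\<And>x. \<exists>c. (\<forall>b\<in>B. c b \<in> E) \<and> x = (\<Sum>b\<in>B. c b * b)"
    using span unfolding finitely_spanned_def by auto
  show ?thesis
  proof (rule finitely_spannedI[of _ _ "card B"])
    show "division_subring (center_of :: 'a set)"
      unfolding center_of_eq_commutant by (rule division_subring_commutant)
    fix J assume J: "finite J" "J \<subseteq> E" "card B < card J"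
    define P where "P d \<longleftrightarrow> (\<forall>x. (\<Sum>j\<in>J. j * x * d j) = 0)" for d
    obtain c where c: "\<exists>j\<in>J. c j \<noteq> 0" "\<And>b. b \<in> B \<Longrightarrow> (\<Sum>j\<in>J. j * b * c j) = 0"
      using right_linear_system[OF B(1) J(1,3), of "\<lambda>b j. j * b"] by blast
    \<comment> \<open>The identity at the spanning elements \<open>b\<close> implies it at every
      \<open>x\<close>: \<open>j\<close> and \<open>k b\<close> both lie in the commutative
      \<open>E\<close>, so \<open>k b\<close> moves to the front.\<close>
    have "P c" unfolding P_def
    proof
      fix x obtain k where k: "\<And>b. b \<in> B \<Longrightarrow> k b \<in> E" "x = (\<Sum>b\<in>B. k b * b)" using B(2)[of x] by blast
      have "(\<Sum>j\<in>J. j * x * c j) = (\<Sum>j\<in>J. \<Sum>b\<in>B. k b * (j * b * c j))"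
      proof (intro sum.cong refl)
        fix j assume j: "j \<in> J"
        have "j * (k b * b) = k b * (j * b)" if "b \<in> B" for b
          using E(2)[of j "k b"] J k(1) j that by (simp add: mult.assoc[symmetric] subset_iff)
        then show "j * x * c j = (\<Sum>b\<in>B. k b * (j * b * c j))"
          unfolding k(2) sum_distrib_left sum_distrib_right by (intro sum.cong refl) (simp add: mult.assoc)
      qed
      also have "\<dots> = (\<Sum>b\<in>B. k b * (\<Sum>j\<in>J. j * b * c j))"
        by (subst sum.swap) (simp add: sum_distrib_left)
      finally show "(\<Sum>j\<in>J. j * x * c j) = 0" using c by simp
    qed
    then obtain d where d: "P d" "\<exists>j\<in>J. d j \<noteq> 0"
      and min: "\<And>e k. P e \<Longrightarrow> (\<And>j. j \<in> J \<Longrightarrow> d j = 0 \<Longrightarrow> e j = 0) \<Longrightarrow> k \<in> J \<Longrightarrow> d k \<noteq> 0 \<Longrightarrow>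
        e k = 0 \<Longrightarrow> \<forall>j\<in>J. e j = 0"
      using minimal_support[of P c J] c J by blast
    from d(2) obtain j0 where j0: "j0 \<in> J" "d j0 \<noteq> 0" by blast
    define e where "e j = d j * inverse (d j0)" for j
    have e0: "(\<Sum>j\<in>J. j * x * e j) = 0" for x
    proof -
      have "(\<Sum>j\<in>J. j * x * e j) = (\<Sum>j\<in>J. j * x * d j) * inverse (d j0)"
        by (simp add: e_def sum_distrib_right mult.assoc)
      then show ?thesis using d(1) by (simp add: P_def)
    qed
    have comm: "\<forall>j\<in>J. y * e j - e j * y = 0" for y
    proof (rule min[of _ j0])
      have "(\<Sum>j\<in>J. j * x * (y * e j - e j * y)) = 0" for x
      proof -
        have "(\<Sum>j\<in>J. j * x * (y * e j - e j * y))
            = (\<Sum>j\<in>J. j * (x * y) * e j) - (\<Sum>j\<in>J. j * x * e j) * y"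
          by (simp add: sum_distrib_right right_diff_distrib sum_subtractf mult.assoc)
        then show ?thesis by (simp only: e0) simp
      qed
      then show "P (\<lambda>j. y * e j - e j * y)" by (simp add: P_def)
    qed (use j0 in \<open>auto simp: e_def\<close>)
    have F: "e j \<in> center_of" if "j \<in> J" for j
      using comm that by (auto simp: center_of_def)
    have "(\<Sum>j\<in>J. e j * j) = (\<Sum>j\<in>J. j * 1 * e j)"
      using F by (intro sum.cong refl) (simp add: center_of_def)
    then have "(\<Sum>j\<in>J. e j * j) = 0" using e0 by metis
    moreover have "e j0 \<noteq> 0" using j0 by (simp add: e_def)
    ultimately show "\<exists>c. (\<forall>b\<in>J. c b \<in> center_of) \<and> (\<exists>b\<in>J. c b \<noteq> 0) \<and> (\<Sum>b\<in>J. c b * b) = 0"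
      using F j0 by (intro exI[of _ e]) auto
  qed
qed

subsection \<open>Conjugation\<close>

definition conjugate :: "'a::division_ring \<Rightarrow> 'a \<Rightarrow> 'a" where
  "conjugate c x = c * x * inverse c"

text \<open>Both directions are required, since for an infinite \<open>B\<close> an inclusion of
  \<open>y B y^-1\<close> in \<open>B\<close> need not be an equality.\<close>

definition normalizes :: "'a::division_ring \<Rightarrow> 'a set \<Rightarrow> bool" where
  "normalizes y B \<longleftrightarrow> y \<noteq> 0 \<and> (\<forall>b\<in>B. conjugate y b \<in> B \<and> conjugate (inverse y) b \<in> B)"

lemma conjugate_add: "conjugate c (x + y) = conjugate c x + conjugate c y"
  and conjugate_diff: "conjugate c (x - y) = conjugate c x - conjugate c y"
  and conjugate_minus: "conjugate c (- x) = - conjugate c x"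
  and conjugate_minus_left: "conjugate (- c) x = conjugate c x"
  by (simp_all add: conjugate_def algebra_simps)

lemma conjugate_sum: "conjugate c (sum f I) = (\<Sum>i\<in>I. conjugate c (f i))"
  by (simp add: conjugate_def sum_distrib_left sum_distrib_right)

lemma conjugate_mult: "c \<noteq> 0 \<Longrightarrow> conjugate c (x * y) = conjugate c x * conjugate c y"
proof -
  assume c: "c \<noteq> 0"
  have "conjugate c x * conjugate c y = c * x * (inverse c * c) * y * inverse c"
    by (simp only: conjugate_def mult.assoc)
  also have "\<dots> = conjugate c (x * y)" unfolding left_inverse[OF c] by (simp add: conjugate_def mult.assoc)
  finally show ?thesis ..
qed

lemma conjugate_one [simp]: "c \<noteq> 0 \<Longrightarrow> conjugate c 1 = 1"
  by (simp add: conjugate_def)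

lemma conjugate_eq_0_iff [simp]: "c \<noteq> 0 \<Longrightarrow> conjugate c x = 0 \<longleftrightarrow> x = 0"
  by (simp add: conjugate_def)

lemma conjugate_inverse: "c \<noteq> 0 \<Longrightarrow> conjugate c (inverse x) = inverse (conjugate c x)"
  by (cases "x = 0") (simp_all add: conjugate_def nonzero_inverse_mult_distrib mult.assoc)

lemma conjugate_conjugate: "c \<noteq> 0 \<Longrightarrow> d \<noteq> 0 \<Longrightarrow> conjugate c (conjugate d x) = conjugate (c * d) x"
  by (simp add: conjugate_def nonzero_inverse_mult_distrib mult.assoc)

lemma conjugate_one_left [simp]: "conjugate 1 x = x"
  by (simp add: conjugate_def)

lemma conjugate_power: "c \<noteq> 0 \<Longrightarrow> conjugate c (x ^ n) = conjugate c x ^ n"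
  by (induction n) (simp_all add: conjugate_mult)

lemma conjugate_eq_iff: "c \<noteq> 0 \<Longrightarrow> conjugate c x = y \<longleftrightarrow> c * x = y * c"
  by (metis conjugate_def mult.assoc mult.right_neutral right_inverse left_inverse)

lemma conjugate_eq_self_iff: "c \<noteq> 0 \<Longrightarrow> conjugate c x = x \<longleftrightarrow> c * x = x * c"
  by (rule conjugate_eq_iff)

lemma normalizes_conjugate: "normalizes y B \<Longrightarrow> b \<in> B \<Longrightarrow> conjugate y b \<in> B"
  and normalizes_conjugate_inverse: "normalizes y B \<Longrightarrow> b \<in> B \<Longrightarrow> conjugate (inverse y) b \<in> B"
  and normalizes_nonzero: "normalizes y B \<Longrightarrow> y \<noteq> 0"
  by (auto simp: normalizes_def)

lemma normalizes_minus: "normalizes y B \<Longrightarrow> normalizes (- y) B"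
  by (simp add: normalizes_def conjugate_minus_left)

text \<open>The Cartan--Brauer--Hua computation, localised to a single element.\<close>

lemma normalizing_element_cases:
  assumes L: "division_subring L" and y: "normalizes y L" "normalizes (y + 1) L"
  shows "y \<in> L \<or> y \<in> commutant L"
proof (rule disjCI)
  assume "y \<notin> commutant L"
  then obtain x where x: "x \<in> L" "x * y \<noteq> y * x" by (auto simp: commutant_iff)
  define x' x'' where "x' = conjugate y x" and "x'' = conjugate (y + 1) x"
  have L': "x' \<in> L" "x'' \<in> L"
    using x y by (auto simp: x'_def x''_def normalizes_conjugate)
  have eqs: "y * x = x' * y" "(y + 1) * x = x'' * (y + 1)"
    using conjugate_eq_iff[of y x x'] conjugate_eq_iff[of "y + 1" x x'']
    by (simp_all add: x'_def x''_def normalizes_nonzero[OF y(1)] normalizes_nonzero[OF y(2)])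
  \<comment> \<open>Subtracting the two relations eliminates \<open>y * x\<close> and leaves an
    equation linear in \<open>y\<close> with coefficients in \<open>L\<close>.\<close>
  then have *: "(x' - x'') * y = x'' - x" by (simp add: algebra_simps)
  have "x' \<noteq> x''"
  proof
    assume "x' = x''"
    then show False using * eqs x by simp
  qed
  then have "y = inverse (x' - x'') * ((x' - x'') * y)" by (simp flip: mult.assoc)
  then have "y = inverse (x' - x'') * (x'' - x)" by (simp only: *)
  then show "y \<in> L" using L' x by (metis division_subringD(4,6,7)[OF L])
qed

subsection \<open>Groups of class two\<close>

text \<open>A multiplicative group, nilpotent of class at most two because its commutators
  centralize it. It is kept as a bare subset of the ring so that sums of its elements can be
  formed.\<close>

locale class_two =
  fixes B :: "'a::division_ring set"
  assumes one: "1 \<in> B" and zero: "0 \<notin> B"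
    and mult: "\<And>b c. b \<in> B \<Longrightarrow> c \<in> B \<Longrightarrow> b * c \<in> B"
    and inv: "\<And>b. b \<in> B \<Longrightarrow> inverse b \<in> B"
    and commutator: "\<And>b c. b \<in> B \<Longrightarrow> c \<in> B \<Longrightarrow> b * c * inverse b * inverse c \<in> commutant B"
begin

text \<open>The center of the double centralizer of \<open>B\<close>. Its elements serve as scalars,
  and \<open>B \<inter> Z\<close> is the center of \<open>B\<close>.\<close>

definition Z where "Z = commutant B \<inter> commutant (commutant B)"

text \<open>The commutator of \<open>c\<close> and \<open>p\<close>, read as the eigenvalue of the
  eigenvector \<open>p\<close> under conjugation by \<open>c\<close>.\<close>

definition weight where "weight c p = conjugate c p * inverse p"

lemma nonzero: "b \<in> B \<Longrightarrow> b \<noteq> 0"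
  using zero by auto

lemma power: "b \<in> B \<Longrightarrow> b ^ n \<in> B"
  by (induction n) (auto simp: one mult)

lemma Z_subring: "division_subring Z"
  unfolding Z_def by (intro division_subring_Int division_subring_commutant)

lemma B_subset: "B \<subseteq> commutant (commutant B)"
  by (rule subset_commutant_commutant)

lemma Z_iff: "b \<in> B \<Longrightarrow> b \<in> Z \<longleftrightarrow> b \<in> commutant B"
  using B_subset by (auto simp: Z_def)

lemma Z_commute: "z \<in> Z \<Longrightarrow> x \<in> commutant (commutant B) \<Longrightarrow> z * x = x * z"
  by (auto simp: Z_def commutant_iff)

lemma Z_commute_Z: "z \<in> Z \<Longrightarrow> x \<in> Z \<Longrightarrow> z * x = x * z"
  using Z_commute by (auto simp: Z_def)

lemma Z_commute_B: "z \<in> Z \<Longrightarrow> b \<in> B \<Longrightarrow> z * b = b * z"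
  using Z_commute B_subset by blast

lemma conjugate_Z: "c \<in> B \<Longrightarrow> z \<in> Z \<Longrightarrow> conjugate c z = z"
  by (simp add: conjugate_eq_self_iff nonzero Z_commute_B)

lemma conjugate_closed: "c \<in> B \<Longrightarrow> b \<in> B \<Longrightarrow> conjugate c b \<in> B"
  by (simp add: conjugate_def mult inv)

lemma weight_Z: assumes "c \<in> B" "p \<in> B" shows "weight c p \<in> Z"
proof -
  have "weight c p \<in> B" by (simp add: weight_def mult inv conjugate_closed assms)
  moreover have "weight c p = c * p * inverse c * inverse p" by (simp add: weight_def conjugate_def)
  ultimately show ?thesis using Z_iff commutator[OF assms] by simp
qed

lemma conjugate_weight: "p \<in> B \<Longrightarrow> conjugate c p = weight c p * p"
  by (simp add: weight_def mult.assoc nonzero)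

lemma conjugate_term:
  "c \<in> B \<Longrightarrow> z \<in> Z \<Longrightarrow> p \<in> B \<Longrightarrow> conjugate c (z * p) = weight c p * (z * p)"
  using Z_commute_Z[OF weight_Z[of c p], of z]
  by (simp add: conjugate_mult nonzero conjugate_Z conjugate_weight flip: mult.assoc)

lemma commute_if_same_weight:
  assumes "c \<in> B" "p \<in> B" "conjugate c u = weight c p * u"
  shows "c * (inverse p * u) = inverse p * u * c"
proof -
  have w: "weight c p \<noteq> 0" using assms by (simp add: weight_def nonzero)
  have "conjugate c (inverse p * u) = inverse (weight c p * p) * (weight c p * u)"
    using assms by (simp add: conjugate_mult conjugate_inverse nonzero flip: conjugate_weight)
  also have "\<dots> = inverse p * (inverse (weight c p) * weight c p) * u"
    using w assms by (simp only: nonzero_inverse_mult_distrib[OF w nonzero] mult.assoc)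
  also have "\<dots> = inverse p * u" using w by simp
  finally show ?thesis using assms by (simp add: conjugate_eq_self_iff nonzero)
qed

text \<open>Elements of \<open>B\<close> in different cosets of \<open>Z\<close> have different weights under conjugation by \<open>B\<close>;
  this is Dedekind's argument for eigenvectors.\<close>

lemma independent:
  assumes "finite J" and "p0 \<in> B" and "\<And>j. j \<in> J \<Longrightarrow> p j \<in> B"
    and "\<And>j. j \<in> J \<Longrightarrow> inverse p0 * p j \<notin> commutant B"
  shows "\<And>z0 z. \<lbrakk>z0 \<in> Z; \<And>j. j \<in> J \<Longrightarrow> z j \<in> Z; z0 * p0 + (\<Sum>j\<in>J. z j * p j) = 0\<rbrakk> \<Longrightarrow> z0 = 0"
  using assms(1,3,4)
proof (induction J rule: finite_induct)
  case empty
  then show ?case using nonzero[OF assms(2)] by simp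
next
  case (insert k J)
  obtain c where c: "c \<in> B" "c * (inverse p0 * p k) \<noteq> inverse p0 * p k * c"
    using insert.prems(5)[of k] by (auto simp: commutant_iff)
  then have ne: "weight c p0 - weight c (p k) \<noteq> 0"
    using commute_if_same_weight[OF c(1) assms(2), of "p k"] conjugate_weight[of "p k" c] insert.prems(4)
    by auto
  have W: "weight c p0 \<in> Z" "\<And>j. j \<in> insert k J \<Longrightarrow> weight c (p j) \<in> Z"
    using weight_Z c assms(2) insert.prems(4) by auto
  let ?w = "weight c (p k)"
  \<comment> \<open>Conjugating the relation by \<open>c\<close> and subtracting \<open>?w\<close>
    times it removes the term of \<open>k\<close> and multiplies \<open>z0\<close> by a nonzero
    difference of weights.\<close>
  have "conjugate c (z0 * p0 + (\<Sum>j\<in>insert k J. z j * p j))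
      - ?w * (z0 * p0 + (\<Sum>j\<in>insert k J. z j * p j)) = 0"
    using insert.prems(3) by (simp add: conjugate_def)
  moreover have "conjugate c (z0 * p0 + (\<Sum>j\<in>insert k J. z j * p j))
      = weight c p0 * (z0 * p0) + (\<Sum>j\<in>insert k J. weight c (p j) * (z j * p j))"
    unfolding conjugate_add conjugate_sum
    using insert.prems assms(2) c by (intro arg_cong2[of _ _ _ _ "(+)"] sum.cong conjugate_term refl) auto
  ultimately have "(weight c p0 - ?w) * z0 * p0 + (\<Sum>j\<in>J. (weight c (p j) - ?w) * z j * p j) = 0"
    using insert.hyps by (simp add: algebra_simps sum_distrib_left sum_subtractf)
  then have "(weight c p0 - ?w) * z0 = 0"
  proof (rule insert.IH[rotated 2])
    show "(weight c p0 - ?w) * z0 \<in> Z"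
      using W insert.prems by (intro division_subringD[OF Z_subring]) auto
    show "(weight c (p j) - ?w) * z j \<in> Z" if "j \<in> J" for j
      using W insert.prems that by (intro division_subringD[OF Z_subring]) auto
  qed (use insert.prems in auto)
  then show ?case using ne by simp
qed

text \<open>\<open>independent\<close> alone does not give this, because several \<open>p i\<close>,
  or several \<open>q j\<close>, may share a coset. For a common element \<open>u\<close> of the two
  spans, \<open>conjugate c u - weight c (q k) * u\<close> no longer involves \<open>q k\<close>, so
  it vanishes by induction. Hence \<open>u\<close> has the weights of \<open>q k\<close> and is a
  scalar multiple of it, and \<open>independent\<close> makes the scalar 0.\<close>

lemma disjoint_spans:
  assumes "finite I" "finite J" and "\<And>i. i \<in> I \<Longrightarrow> p i \<in> B" and "\<And>j. j \<in> J \<Longrightarrow> q j \<in> B"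
    and "\<And>i j. i \<in> I \<Longrightarrow> j \<in> J \<Longrightarrow> inverse (q j) * p i \<notin> commutant B"
  shows "\<And>z w. \<lbrakk>\<And>i. i \<in> I \<Longrightarrow> z i \<in> Z; \<And>j. j \<in> J \<Longrightarrow> w j \<in> Z;
    (\<Sum>i\<in>I. z i * p i) = (\<Sum>j\<in>J. w j * q j)\<rbrakk> \<Longrightarrow> (\<Sum>i\<in>I. z i * p i) = 0"
  using assms(2,4,5)
proof (induction J rule: finite_induct)
  case empty
  then show ?case by simp
next
  case (insert k J)
  define u where "u = (\<Sum>i\<in>I. z i * p i)"
  have qk: "q k \<in> B" using insert.prems by simp
  have u_cc: "u \<in> commutant (commutant B)"
    unfolding u_def using assms(3) insert.prems B_subset
    by (intro division_subring_sum division_subring_commutant division_subringD(4)[OF division_subring_commutant])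
       (auto simp: Z_def)
  have weight_u: "conjugate c u = weight c (q k) * u" if c: "c \<in> B" for c
  proof -
    let ?w = "weight c (q k)"
    have u1: "conjugate c u - ?w * u = (\<Sum>i\<in>I. (weight c (p i) - ?w) * z i * p i)"
      unfolding u_def conjugate_sum
      using insert.prems(1) assms(3) c by (simp add: conjugate_term algebra_simps sum_distrib_left sum_subtractf)
    have "conjugate c u - ?w * u = (\<Sum>j\<in>insert k J. (weight c (q j) - ?w) * w j * q j)"
      unfolding u_def insert.prems(3) conjugate_sum using insert.prems(1,2,4) c
      by (simp add: conjugate_term algebra_simps sum_distrib_left sum_subtractf del: sum.insert)
    then have u2: "conjugate c u - ?w * u = (\<Sum>j\<in>J. (weight c (q j) - ?w) * w j * q j)"
      using insert.hyps by simp
    have "(\<Sum>i\<in>I. (weight c (p i) - ?w) * z i * p i) = 0"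
    proof (rule insert.IH)
      show "(weight c (p i) - ?w) * z i \<in> Z" if "i \<in> I" for i
        using that insert.prems(1) assms(3) qk c by (intro division_subringD[OF Z_subring] weight_Z) auto
      show "(weight c (q j) - ?w) * w j \<in> Z" if "j \<in> J" for j
        using that insert.prems qk c by (intro division_subringD[OF Z_subring] weight_Z) auto
    qed (use u1 u2 insert.prems in auto)
    then show ?thesis using u1 by simp
  qed
  define t where "t = inverse (q k) * u"
  have "t \<in> commutant B"
    using commute_if_same_weight[OF _ qk weight_u] by (auto simp: t_def commutant_iff)
  moreover have "t \<in> commutant (commutant B)"
    unfolding t_def using u_cc qk B_subset by (intro division_subringD[OF division_subring_commutant]) auto
  ultimately have t: "t \<in> Z" by (simp add: Z_def)
  have "u = q k * t" using nonzero[OF qk] by (simp add: t_def flip: mult.assoc)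
  then have ut: "u = t * q k" using Z_commute_B[OF t qk] by simp
  have "- t = 0"
  proof (rule independent[OF assms(1) qk, of p "- t" z])
    show "- t * q k + (\<Sum>i\<in>I. z i * p i) = 0" using ut by (simp add: u_def)
  qed (use t insert.prems assms(3) in \<open>auto intro: division_subringD[OF Z_subring]\<close>)
  then show ?case using ut by (simp add: u_def)
qed

text \<open>If \<open>c x c\<^sup>-\<^sup>1 = x p\<close> and \<open>c (x + 1) c\<^sup>-\<^sup>1 = (x + 1) r\<close>, then \<open>x (p - r) = r - 1\<close>. Conjugating this
  relation by \<open>d\<close>, with \<open>d x d\<^sup>-\<^sup>1 = x e\<close>, and eliminating \<open>x\<close> gives two expansions of one nonzero element,
  along \<open>p r, p, r r, r\<close> and along \<open>e\<close> times these elements. By independence they share a coset.\<close>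

lemma conjugates_finite_mod_Z:
  assumes x: "normalizes x B" "normalizes (x + 1) B" "x \<notin> commutant B"
  obtains s :: "nat \<Rightarrow> 'a" where "\<And>i. s i \<in> B"
    "\<And>d. d \<in> B \<Longrightarrow> \<exists>i<4. \<exists>j<4. \<exists>\<zeta>\<in>Z. \<zeta> \<noteq> 0 \<and> conjugate d x = x * (\<zeta> * (s j * inverse (s i)))"
proof -
  have x0: "x \<noteq> 0" "x + 1 \<noteq> 0" using x normalizes_nonzero by auto
  \<comment> \<open>The factor is \<open>inverse y * d * y * inverse d\<close>, which lies in
    \<open>B\<close> because \<open>y\<close> normalizes \<open>B\<close>.\<close>
  have twist: "\<exists>e\<in>B. conjugate d y = y * e" if "normalizes y B" "d \<in> B" for d y
  proof
    show "inverse y * conjugate d y \<in> B"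
      using mult[OF normalizes_conjugate_inverse[OF that] inv[OF that(2)]] that
      by (simp add: conjugate_def mult.assoc normalizes_nonzero)
    show "conjugate d y = y * (inverse y * conjugate d y)"
      using normalizes_nonzero[OF that(1)] by (simp flip: mult.assoc)
  qed
  obtain c where c: "c \<in> B" "c * x \<noteq> x * c" using x by (auto simp: commutant_iff)
  obtain p r where p: "p \<in> B" "conjugate c x = x * p" and r: "r \<in> B" "conjugate c (x + 1) = (x + 1) * r"
    using twist x c by meson
  have rel: "x * (p - r) = r - 1"
    using p r c nonzero[OF c(1)] by (simp add: conjugate_add algebra_simps)
  have "r \<noteq> 1"
  proof
    assume "r = 1"
    then have "conjugate c x = x" using r c nonzero[OF c(1)] by (simp add: conjugate_add)
    then show False using c nonzero by (simp add: conjugate_eq_self_iff)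
  qed
  then have "p \<noteq> r" using rel by auto
  define s where "s = (\<lambda>i::nat. if i = 0 then p * r else if i = 1 then p else if i = 2 then r * r else r)"
  have s: "s i \<in> B" for i using p r by (simp add: s_def mult)
  have four: "(\<Sum>i<4. f i) = f 0 + f 1 + f 2 + f 3" for f :: "nat \<Rightarrow> 'a"
    by (simp add: numeral_eq_Suc)
  have "\<exists>i<4. \<exists>j<4. \<exists>\<zeta>\<in>Z. \<zeta> \<noteq> 0 \<and> conjugate d x = x * (\<zeta> * (s j * inverse (s i)))" if d: "d \<in> B" for d
  proof -
    obtain e where e: "e \<in> B" "conjugate d x = x * e" using twist x d by blast
    define \<beta> \<gamma> where "\<beta> = weight d p" and "\<gamma> = weight d r"
    have \<beta>\<gamma>: "\<beta> \<in> Z" "\<gamma> \<in> Z" using weight_Z d p r by (auto simp: \<beta>_def \<gamma>_def)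
    have d0: "d \<noteq> 0" using nonzero d by simp
    have conj_rel: "x * (e * (\<beta> * p - \<gamma> * r)) = \<gamma> * r - 1"
    proof -
      have "conjugate d (x * (p - r)) = conjugate d (r - 1)" using rel by simp
      then show ?thesis
        using d0 e p r by (simp add: conjugate_mult conjugate_diff conjugate_weight \<beta>_def \<gamma>_def mult.assoc)
    qed
    have nz: "\<gamma> * r - 1 \<noteq> 0"
    proof -
      have "conjugate d (r - 1) = \<gamma> * r - 1"
        using d0 r by (simp add: conjugate_diff conjugate_weight \<gamma>_def)
      then show ?thesis using d0 \<open>r \<noteq> 1\<close> by (metis conjugate_eq_0_iff right_minus_eq)
    qed
    have comm: "e * (\<beta> * t) = \<beta> * (e * t)" "e * (\<gamma> * t) = \<gamma> * (e * t)"
      "p * (\<gamma> * t) = \<gamma> * (p * t)" "r * (\<gamma> * t) = \<gamma> * (r * t)" for t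
      using Z_commute_B \<beta>\<gamma> e p r by (metis mult.assoc)+
    \<comment> \<open>Since \<open>r - 1\<close> and \<open>\<gamma> * r - 1\<close> commute,
      \<open>conj_rel\<close> and \<open>rel\<close> can be cross-multiplied and \<open>x\<close>
      cancelled on the left.\<close>
    have "x * (e * (\<beta> * p - \<gamma> * r) * (r - 1)) = (\<gamma> * r - 1) * (r - 1)"
      using conj_rel by (simp flip: mult.assoc)
    also have "\<dots> = (r - 1) * (\<gamma> * r - 1)"
      using comm(4)[of r] by (simp add: algebra_simps)
    also have "\<dots> = x * ((p - r) * (\<gamma> * r - 1))" by (simp add: mult.assoc flip: rel)
    finally have main: "e * (\<beta> * p - \<gamma> * r) * (r - 1) = (p - r) * (\<gamma> * r - 1)"
      using x0 by simp
    define z w where "z = (\<lambda>i::nat. if i = 0 then \<gamma> else if i = 1 then - 1 else if i = 2 then - \<gamma> else 1)"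
      and "w = (\<lambda>i::nat. if i = 0 then \<beta> else if i = 1 then - \<beta> else if i = 2 then - \<gamma> else \<gamma>)"
    have zZ: "z i \<in> Z" and wZ: "w i \<in> Z" for i
      using \<beta>\<gamma> division_subringD[OF Z_subring] by (auto simp: z_def w_def)
    have rhs: "(\<Sum>i<4. z i * s i) = (p - r) * (\<gamma> * r - 1)"
      unfolding four by (simp add: z_def s_def algebra_simps comm)
    have lhs: "(\<Sum>i<4. w i * (e * s i)) = e * (\<beta> * p - \<gamma> * r) * (r - 1)"
      unfolding four by (simp add: w_def s_def algebra_simps comm)
    have "\<exists>i<4. \<exists>j<4. inverse (e * s j) * s i \<in> commutant B"
    proof (rule ccontr)
      assume no: "\<not> ?thesis"
      have "(\<Sum>i<4. z i * s i) = 0"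
      proof (rule disjoint_spans[of "{..<4}" "{..<4}" s "\<lambda>i. e * s i" z w])
        show "(\<Sum>i<4. z i * s i) = (\<Sum>i<4. w i * (e * s i))" using lhs rhs main by simp
      qed (use no zZ wZ s e mult in auto)
      then show False using rhs nz \<open>p \<noteq> r\<close> by simp
    qed
    then obtain i j where ij: "i < 4" "j < 4" "inverse (e * s j) * s i \<in> commutant B" by blast
    define \<zeta> where "\<zeta> = inverse (inverse (e * s j) * s i)"
    have B: "inverse (e * s j) * s i \<in> B" using e s mult inv by simp
    then have \<zeta>: "\<zeta> \<in> Z" "\<zeta> \<noteq> 0"
      unfolding \<zeta>_def using ij Z_iff[OF B] nonzero[OF B] division_subringD(6)[OF Z_subring]
      by simp_all
    have nzs: "e \<noteq> 0" "s i \<noteq> 0" "s j \<noteq> 0" using e s nonzero by auto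
    then have "\<zeta> = inverse (s i) * (e * s j)"
      by (simp add: \<zeta>_def nonzero_inverse_mult_distrib mult.assoc)
    then have "s i * \<zeta> * inverse (s j) = e"
      using nzs by (simp add: mult.assoc) (simp flip: mult.assoc)
    then have "e = \<zeta> * (s i * inverse (s j))"
      using Z_commute_B[OF \<zeta>(1) s[of i]] by (simp flip: mult.assoc)
    then show ?thesis using e ij \<zeta> by blast
  qed
  then show ?thesis using that s by blast
qed

text \<open>The colour of \<open>d\<close> is the index pair supplied by
  \<open>conjugates_finite_mod_Z\<close>; two conjugates of \<open>x\<close> with the same pair
  differ only in the scalar \<open>\<zeta>\<close>.\<close>

lemma proportional_conjugates_colouring:
  assumes "normalizes x B" "normalizes (x + 1) B" "x \<notin> commutant B"
  obtains f :: "'a \<Rightarrow> nat \<times> nat" where "f ` B \<subseteq> {..<4} \<times> {..<4}"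
    "\<And>d d'. d \<in> B \<Longrightarrow> d' \<in> B \<Longrightarrow> f d = f d' \<Longrightarrow> \<exists>\<kappa>\<in>Z. conjugate d' x = conjugate d x * \<kappa>"
proof -
  obtain s :: "nat \<Rightarrow> 'a" where s: "\<And>i. s i \<in> B"
    "\<And>d. d \<in> B \<Longrightarrow> \<exists>i<4. \<exists>j<4. \<exists>\<zeta>\<in>Z. \<zeta> \<noteq> 0 \<and> conjugate d x = x * (\<zeta> * (s j * inverse (s i)))"
    using conjugates_finite_mod_Z[OF assms] by metis
  have "\<forall>d. \<exists>k. d \<in> B \<longrightarrow> k \<in> {..<4} \<times> {..<4} \<and>
      (\<exists>\<zeta>\<in>Z. \<zeta> \<noteq> 0 \<and> conjugate d x = x * (\<zeta> * (s (snd k) * inverse (s (fst k)))))"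
    using s(2) by fastforce
  then obtain f where f: "\<And>d. d \<in> B \<Longrightarrow> f d \<in> {..<4} \<times> {..<4}"
    "\<And>d. d \<in> B \<Longrightarrow> \<exists>\<zeta>\<in>Z. \<zeta> \<noteq> 0 \<and> conjugate d x = x * (\<zeta> * (s (snd (f d)) * inverse (s (fst (f d)))))"
    by metis
  show ?thesis
  proof (rule that[of f])
    fix d d' assume d: "d \<in> B" "d' \<in> B" "f d = f d'"
    define t where "t = s (snd (f d)) * inverse (s (fst (f d)))"
    obtain \<zeta> \<zeta>' where z: "\<zeta> \<in> Z" "\<zeta> \<noteq> 0" "conjugate d x = x * (\<zeta> * t)" "\<zeta>' \<in> Z" "conjugate d' x = x * (\<zeta>' * t)"
      using f(2) d unfolding t_def by metis
    have \<kappa>: "inverse \<zeta> * \<zeta>' \<in> Z" using z by (intro division_subringD[OF Z_subring])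
    have "t \<in> B" using s by (simp add: t_def mult inv)
    have "\<zeta> * t * (inverse \<zeta> * \<zeta>') = \<zeta> * ((inverse \<zeta> * \<zeta>') * t)"
      using Z_commute_B[OF \<kappa> \<open>t \<in> B\<close>] by (simp only: mult.assoc)
    also have "\<dots> = (\<zeta> * inverse \<zeta>) * \<zeta>' * t" by (simp only: mult.assoc)
    finally have "\<zeta>' * t = \<zeta> * t * (inverse \<zeta> * \<zeta>')" using z by simp
    then have "conjugate d' x = conjugate d x * (inverse \<zeta> * \<zeta>')" using z by (simp add: mult.assoc)
    then show "\<exists>\<kappa>\<in>Z. conjugate d' x = conjugate d x * \<kappa>" using \<kappa> by blast
  qed (use f in blast)
qed

text \<open>For \<open>u = inverse d * d'\<close> with equal colours, conjugation by
  \<open>u\<close> multiplies \<open>x\<close> by a scalar \<open>\<kappa>\<close> and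
  \<open>x + 1\<close> by a scalar \<open>\<mu>\<close>. Comparison gives
  \<open>x * (\<kappa> - \<mu>) = \<mu> - 1\<close>, and as \<open>x\<close> is not a scalar,
  \<open>\<kappa> = \<mu> = 1\<close>.\<close>

lemma commuting_quotient_colouring:
  assumes x: "normalizes x B" "normalizes (x + 1) B" "x \<notin> commutant B"
  obtains f :: "'a \<Rightarrow> (nat \<times> nat) \<times> (nat \<times> nat)"
  where "f ` B \<subseteq> ({..<4} \<times> {..<4}) \<times> ({..<4} \<times> {..<4})"
    "\<And>d d'. d \<in> B \<Longrightarrow> d' \<in> B \<Longrightarrow> f d = f d' \<Longrightarrow> inverse d * d' * x = x * (inverse d * d')"
proof -
  obtain f :: "'a \<Rightarrow> nat \<times> nat" where f: "f ` B \<subseteq> {..<4} \<times> {..<4}"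
    "\<And>d d'. d \<in> B \<Longrightarrow> d' \<in> B \<Longrightarrow> f d = f d' \<Longrightarrow> \<exists>\<kappa>\<in>Z. conjugate d' x = conjugate d x * \<kappa>"
    by (rule proportional_conjugates_colouring[OF x]) (rule that)
  \<comment> \<open>The previous colouring needs an element that normalizes \<open>B\<close>
    together with its successor. For \<open>- (x + 1)\<close> the successor is \<open>- x\<close>,
    whereas \<open>x + 1\<close> itself would call for \<open>x + 2\<close>.\<close>
  have x1: "- (x + 1) \<notin> commutant B"
  proof
    assume "- (x + 1) \<in> commutant B"
    then have "- (- (x + 1)) - 1 \<in> commutant B"
      by (rule division_subringD(7)[OF division_subring_commutant division_subringD(5,2)[OF division_subring_commutant]])
    then show False using x(3) by simp
  qed
  have x2: "normalizes (- (x + 1) + 1) B" using normalizes_minus[OF x(1)] by simp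
  obtain g :: "'a \<Rightarrow> nat \<times> nat" where g: "g ` B \<subseteq> {..<4} \<times> {..<4}"
    "\<And>d d'. d \<in> B \<Longrightarrow> d' \<in> B \<Longrightarrow> g d = g d' \<Longrightarrow>
      \<exists>\<kappa>\<in>Z. conjugate d' (- (x + 1)) = conjugate d (- (x + 1)) * \<kappa>"
    by (rule proportional_conjugates_colouring[OF normalizes_minus[OF x(2)] x2 x1]) (rule that)
  show ?thesis
  proof (rule that[of "\<lambda>d. (f d, g d)"])
    fix d d' assume d: "d \<in> B" "d' \<in> B" "(f d, g d) = (f d', g d')"
    obtain \<kappa> \<mu> where \<kappa>: "\<kappa> \<in> Z" "conjugate d' x = conjugate d x * \<kappa>"
      and \<mu>: "\<mu> \<in> Z" "conjugate d' (- (x + 1)) = conjugate d (- (x + 1)) * \<mu>"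
      using f(2)[OF d(1,2)] g(2)[OF d(1,2)] d(3) by auto
    define u where "u = inverse d * d'"
    have u: "u \<in> B" using d mult inv by (simp add: u_def)
    have conj_u: "conjugate u y = y * \<nu>" if "\<nu> \<in> Z" "conjugate d' y = conjugate d y * \<nu>" for y \<nu>
    proof -
      have "conjugate u y = conjugate (inverse d) (conjugate d' y)"
        using d nonzero by (simp add: u_def conjugate_conjugate)
      also have "\<dots> = conjugate (inverse d) (conjugate d y) * conjugate (inverse d) \<nu>"
        using d nonzero that by (simp add: conjugate_mult)
      also have "\<dots> = y * \<nu>"
        using d nonzero that by (simp add: conjugate_conjugate conjugate_Z inv)
      finally show ?thesis .
    qed
    have 1: "conjugate u x = x * \<kappa>" using conj_u \<kappa> by blast
    have "conjugate u (- (x + 1)) = - (x + 1) * \<mu>" using conj_u \<mu> by blast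
    then have 2: "conjugate u x + 1 = x * \<mu> + \<mu>"
      using u nonzero by (simp add: conjugate_minus conjugate_add conjugate_diff algebra_simps)
    have eq: "x * (\<kappa> - \<mu>) = \<mu> - 1" using 1 2 by (simp add: algebra_simps)
    have "\<kappa> = \<mu>"
    proof (rule ccontr)
      assume "\<kappa> \<noteq> \<mu>"
      then have "x = (x * (\<kappa> - \<mu>)) * inverse (\<kappa> - \<mu>)" by (simp add: mult.assoc)
      also have "\<dots> \<in> Z" unfolding eq using \<kappa> \<mu> by (intro division_subringD[OF Z_subring])
      finally show False using x(3) by (simp add: Z_def)
    qed
    then have "conjugate u x = x" using 1 eq by simp
    then show "inverse d * d' * x = x * (inverse d * d')"
      using u nonzero by (simp add: conjugate_eq_self_iff flip: u_def)
  qed (use f g in blast)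
qed

text \<open>The colouring bounds the index of the center of \<open>B\<close> by
  \<open>card S\<close>. By pigeonhole, each \<open>b\<close> in \<open>B\<close> has
  \<open>k, m \<le> card S\<close> such that \<open>b ^ k\<close> is a scalar and
  \<open>conjugate (y ^ m) b = z * b\<close> with a scalar \<open>z\<close>. As \<open>y\<close>
  commutes with scalars, taking \<open>k\<close>-th powers gives \<open>z ^ k = 1\<close>, so
  \<open>y ^ (m * k)\<close> commutes with \<open>b\<close>. The factorials serve all
  \<open>b\<close> at once.\<close>

lemma bounded_exponent:
  assumes f: "finite S" "f ` B \<subseteq> S"
    "\<And>d d'. d \<in> B \<Longrightarrow> d' \<in> B \<Longrightarrow> f d = f d' \<Longrightarrow> inverse d * d' \<in> commutant B"
    and y: "normalizes y B" "y \<in> commutant (commutant B)"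
  shows "y ^ (fact (card S) * fact (card S)) \<in> commutant B"
proof -
  have y0: "y \<noteq> 0" "y ^ n \<noteq> 0" for n using normalizes_nonzero[OF y(1)] by auto
  have pigeon: "\<exists>i j. i < j \<and> j \<le> card S \<and> inverse (g i) * g j \<in> Z" if g: "\<And>i. g i \<in> B" for g :: "nat \<Rightarrow> 'a"
  proof -
    have "(f \<circ> g) ` {..card S} \<subseteq> S" using f g by auto
    then have "card ((f \<circ> g) ` {..card S}) < card {..card S}"
      using card_mono[OF f(1)] by (metis card_atMost less_Suc_eq_le)
    then obtain i j where "i \<noteq> j" "i \<le> card S" "j \<le> card S" "f (g i) = f (g j)"
      using pigeonhole[of "f \<circ> g" "{..card S}"] by (auto simp: inj_on_def)
    then obtain i j where ij: "i < j" "j \<le> card S" "f (g i) = f (g j)"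
      by (metis linorder_neqE_nat)
    then have "inverse (g i) * g j \<in> Z" using f(3) g Z_iff mult inv by simp
    then show ?thesis using ij by blast
  qed
  have Zy: "conjugate (y ^ n) z = z" if "z \<in> Z" for z n
    using Z_commute[OF that y(2)] commuting_power[of y z n] y0 by (simp add: conjugate_eq_self_iff)
  have "b * y ^ (fact (card S) * fact (card S)) = y ^ (fact (card S) * fact (card S)) * b" if b: "b \<in> B" for b
  proof -
    obtain i j where ij: "i < j" "j \<le> card S" "inverse (b ^ i) * b ^ j \<in> Z"
      using pigeon[of "\<lambda>i. b ^ i"] power b by blast
    define k where "k = j - i"
    have "b ^ j = b ^ i * b ^ k" using ij by (simp add: k_def flip: power_add)
    then have bk: "b ^ k \<in> Z" using ij nonzero[OF b] by (simp flip: mult.assoc)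
    have k: "k dvd fact (card S)" using ij by (intro dvd_fact) (auto simp: k_def)
    have conjB: "conjugate (y ^ n) b \<in> B" for n
    proof (induction n)
      case (Suc n)
      then show ?case using normalizes_conjugate[OF y(1) Suc] y0 by (simp add: conjugate_conjugate)
    qed (use b in simp)
    obtain i j where ij: "i < j" "j \<le> card S" "inverse (conjugate (y ^ i) b) * conjugate (y ^ j) b \<in> Z"
      using pigeon[of "\<lambda>i. conjugate (y ^ i) b"] conjB by blast
    define m where "m = j - i"
    have m: "m dvd fact (card S)" using ij by (intro dvd_fact) (auto simp: m_def)
    define z where "z = inverse b * conjugate (y ^ m) b"
    \<comment> \<open>The coincidence at \<open>i\<close> and \<open>j\<close> is moved back to
      \<open>0\<close> and \<open>m\<close>: conjugation by \<open>y ^ i\<close> fixes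
      \<open>Z\<close> pointwise, and so does its inverse.\<close>
    have "conjugate (y ^ j) b = conjugate (y ^ i) (conjugate (y ^ m) b)"
      using ij y0 by (simp add: m_def conjugate_conjugate flip: power_add)
    then have "conjugate (y ^ i) z \<in> Z"
      using ij y0 by (simp add: z_def conjugate_mult conjugate_inverse)
    moreover have "z = conjugate (inverse (y ^ i)) (conjugate (y ^ i) z)"
      using y0 by (simp add: conjugate_conjugate)
    moreover have "conjugate (inverse (y ^ i)) v = v" if "v \<in> Z" for v
      using Zy[OF that, of i] y0 by (metis conjugate_conjugate conjugate_one_left left_inverse nonzero_imp_inverse_nonzero)
    ultimately have z: "z \<in> Z" by metis
    have step: "conjugate (y ^ m) b = z * b"
      using Z_commute_B[OF z b] nonzero[OF b] by (simp add: z_def flip: mult.assoc)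
    have zb: "z * b = b * z" using Z_commute_B[OF z b] .
    have "(z * b) ^ n = z ^ n * b ^ n" for n
    proof (induction n)
      case (Suc n)
      have "(z * b) ^ Suc n = z * (b * z ^ n) * b ^ n" using Suc by (simp add: mult.assoc)
      also have "b * z ^ n = z ^ n * b" using commuting_power[OF zb, of n] by simp
      finally show ?case by (simp add: mult.assoc)
    qed simp
    then have "z ^ k * b ^ k = b ^ k"
      using Zy[OF bk, of m] y0 by (simp add: conjugate_power step)
    then have zk: "z ^ k = 1" using nonzero[OF b] by simp
    have "conjugate (y ^ (m * n)) b = z ^ n * b" for n
    proof (induction n)
      case (Suc n)
      have "conjugate (y ^ (m * Suc n)) b = conjugate (y ^ m) (conjugate (y ^ (m * n)) b)"
        using y0 by (simp add: conjugate_conjugate flip: power_add)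
      also have "\<dots> = z ^ n * (z * b)"
        unfolding Suc using Zy[of "z ^ n" m] division_subringD(8)[OF Z_subring z] y0
        by (simp add: conjugate_mult step)
      finally show ?case by (simp only: power_Suc2 mult.assoc)
    qed simp
    from this[of k] have comm: "y ^ (m * k) * b = b * y ^ (m * k)"
      using zk y0 by (simp add: conjugate_eq_self_iff)
    have "m * k dvd fact (card S) * fact (card S)" using m k by (rule mult_dvd_mono)
    then obtain l where "fact (card S) * fact (card S) = m * k * l" by (elim dvdE)
    then show ?thesis using commuting_power[OF comm, of l] by (simp add: power_mult)
  qed
  then show ?thesis by (simp add: commutant_iff)
qed

end

subsection \<open>Locally solvable groups\<close>

lemma commutant_commutant_commute:
  assumes "\<And>x y. x \<in> Y \<Longrightarrow> y \<in> Y \<Longrightarrow> x * y = y * x"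
    and "u \<in> commutant (commutant Y)" "v \<in> commutant (commutant Y)"
  shows "u * v = v * u"
proof -
  have "Y \<subseteq> commutant Y" using assms(1) by (auto simp: commutant_iff)
  then have "commutant (commutant Y) \<subseteq> commutant Y" by (rule commutant_antimono)
  then have "v \<in> commutant Y" using assms(3) by blast
  then show ?thesis using assms(2) commutantD[of u "commutant Y" v] by simp
qed

lemma normalizes_commutant:
  assumes "normalizes y B" shows "normalizes y (commutant B)"
proof -
  have *: "conjugate y x \<in> commutant B"
    if y: "y \<noteq> 0" "\<And>b. b \<in> B \<Longrightarrow> conjugate (inverse y) b \<in> B" and x: "x \<in> commutant B" for x y
    unfolding commutant_iff
  proof
    fix b assume "b \<in> B"
    then have "conjugate (inverse y) b * x = x * conjugate (inverse y) b"
      using x y by (simp add: commutant_iff)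
    then have "conjugate y (conjugate (inverse y) b * x) = conjugate y (x * conjugate (inverse y) b)"
      by simp
    then show "b * conjugate y x = conjugate y x * b"
      using y by (simp add: conjugate_mult conjugate_conjugate)
  qed
  have y: "y \<noteq> 0" using assms by (rule normalizes_nonzero)
  show ?thesis
    unfolding normalizes_def
    using y *[of y] *[of "inverse y"] assms by (auto simp: normalizes_def)
qed

section \<open>Multiplicative subgroups and their derived series\<close>

lemma mult_group_simps [simp]:
  "carrier mult_group = - {0}" "x \<otimes>\<^bsub>mult_group\<^esub> y = x * y" "\<one>\<^bsub>mult_group\<^esub> = 1"
  by (simp_all add: mult_group_def)

lemma group_mult_group: "group (mult_group :: 'a::division_ring monoid)"
proof (rule groupI)
  fix x :: 'a assume "x \<in> carrier mult_group"
  then show "\<exists>y\<in>carrier mult_group. y \<otimes>\<^bsub>mult_group\<^esub> x = \<one>\<^bsub>mult_group\<^esub>"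
    by (intro bexI[of _ "inverse x"]) auto
qed (auto simp: mult.assoc)

lemma inv_mult_group: "x \<noteq> 0 \<Longrightarrow> inv\<^bsub>mult_group\<^esub> x = inverse x"
  by (rule group.inv_equality[OF group_mult_group]) auto

lemma subgroup_mult_groupD:
  assumes "subgroup M mult_group"
  shows "0 \<notin> M" "1 \<in> M" "\<And>x y. x \<in> M \<Longrightarrow> y \<in> M \<Longrightarrow> x * y \<in> M" "\<And>x. x \<in> M \<Longrightarrow> inverse x \<in> M"
proof -
  interpret subgroup M mult_group by fact
  show z: "0 \<notin> M" using subset by auto
  show "1 \<in> M" using one_closed by simp
  show "x * y \<in> M" if "x \<in> M" "y \<in> M" for x y using m_closed that by simp
  show "inverse x \<in> M" if "x \<in> M" for x
    using m_inv_closed[OF that] inv_mult_group[of x] z that by (metis (no_types))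
qed

text \<open>\<open>D\<close> is the derived series of the group generated by \<open>S\<close>,
  described by ring operations alone so that it can be combined with addition. The clause on
  \<open>Q\<close> keeps every term inside any division subring containing \<open>S\<close>.\<close>

lemma derived_series:
  fixes M :: "'a::division_ring set"
  assumes M: "subgroup M mult_group" and loc: "locally_solvable (mult_group\<lparr>carrier := M\<rparr>)"
    and S: "finite S" "S \<subseteq> M"
  obtains D :: "nat \<Rightarrow> 'a set" and n where "S \<subseteq> D 0"
    "\<And>Q. division_subring Q \<Longrightarrow> S \<subseteq> Q \<Longrightarrow> D 0 \<subseteq> Q"
    "\<And>i. D i \<subseteq> D 0" "\<And>i. 1 \<in> D i" "\<And>i. 0 \<notin> D i" "\<And>i x y. x \<in> D i \<Longrightarrow> y \<in> D i \<Longrightarrow> x * y \<in> D i"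
    "\<And>i x. x \<in> D i \<Longrightarrow> inverse x \<in> D i"
    "\<And>i x g. g \<in> D 0 \<Longrightarrow> x \<in> D i \<Longrightarrow> conjugate g x \<in> D i"
    "\<And>i x y. x \<in> D i \<Longrightarrow> y \<in> D i \<Longrightarrow> x * y * inverse x * inverse y \<in> D (Suc i)"
    "D n = {1}"
proof -
  define MG where "MG = mult_group\<lparr>carrier := M\<rparr>"
  define \<Gamma> where "\<Gamma> = subgroup_generated MG S"
  interpret MG: group MG
    unfolding MG_def by (rule group.subgroup_imp_group[OF group_mult_group M])
  interpret \<Gamma>: group \<Gamma> unfolding \<Gamma>_def by (rule MG.group_subgroup_generated)
  have ops: "x \<otimes>\<^bsub>\<Gamma>\<^esub> y = x * y" "\<one>\<^bsub>\<Gamma>\<^esub> = 1" for x y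
    by (simp_all add: \<Gamma>_def MG_def subgroup_generated_def)
  have sub: "carrier \<Gamma> \<subseteq> M"
    unfolding \<Gamma>_def using MG.carrier_subgroup_generated_subset[of S] by (simp add: MG_def)
  have inv_MG: "inv\<^bsub>MG\<^esub> x = inverse x" if "x \<in> M" for x
    using that subgroup_mult_groupD[OF M] by (intro MG.inv_equality) (auto simp: MG_def intro!: left_inverse)
  have inv: "inv\<^bsub>\<Gamma>\<^esub> x = inverse x" if "x \<in> carrier \<Gamma>" for x
    unfolding \<Gamma>_def
    using MG.inv_subgroup_generated[of x S] that sub inv_MG by (auto simp: \<Gamma>_def)
  define D where "D i = (derived \<Gamma> ^^ i) (carrier \<Gamma>)" for i
  have D0: "D 0 = carrier \<Gamma>" by (simp add: D_def)
  have sg: "subgroup (D i) \<Gamma>" for i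
    unfolding D_def by (rule \<Gamma>.exp_of_derived_is_subgroup[OF \<Gamma>.subgroup_self])
  have nm: "D i \<lhd> \<Gamma>" for i
  proof (induction i)
    case 0 show ?case by (simp add: D_def \<Gamma>.normal_self)
  next
    case (Suc i) then show ?case using \<Gamma>.derived_is_normal[of "D i"] by (simp add: D_def)
  qed
  have D_sub: "D i \<subseteq> D 0" for i using subgroup.subset[OF sg[of i]] D0 by simp
  have "solvable \<Gamma>" using loc S by (simp add: locally_solvable_def MG_def \<Gamma>_def)
  then obtain n where n: "D n = {1}"
    using \<Gamma>.solvable_iff_trivial_derived_seq by (auto simp: D_def ops)
  show ?thesis
  proof (rule that[of D n])
    show "S \<subseteq> D 0" unfolding D0 \<Gamma>_def
      using MG.subgroup_generated_subset_carrier_subset[of S] S by (simp add: MG_def)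
    show "D 0 \<subseteq> Q" if Q: "division_subring Q" "S \<subseteq> Q" for Q
    proof -
      have "subgroup (Q \<inter> M) MG"
        using Q subgroup_mult_groupD[OF M] division_subringD[OF Q(1)] inv_MG
        by (intro MG.subgroupI) (auto simp: MG_def)
      then have "carrier (subgroup_generated MG S) \<subseteq> Q \<inter> M"
        using Q S by (intro MG.subgroup_generated_minimal) auto
      then show ?thesis by (simp add: D0 \<Gamma>_def)
    qed
    show "D i \<subseteq> D 0" for i by (rule D_sub)
    show "1 \<in> D i" for i using subgroup.one_closed[OF sg[of i]] by (simp add: ops)
    show "0 \<notin> D i" for i using D_sub[of i] sub subgroup_mult_groupD(1)[OF M] by (auto simp: D0)
    show "x * y \<in> D i" if "x \<in> D i" "y \<in> D i" for i x y
      using subgroup.m_closed[OF sg that] by (simp add: ops)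
    show "inverse x \<in> D i" if "x \<in> D i" for i x
      using subgroup.m_inv_closed[OF sg that] inv[of x] D_sub[of i] that by (auto simp: D0)
    show "conjugate g x \<in> D i" if "g \<in> D 0" "x \<in> D i" for i x g
      using normal.inv_op_closed2[OF nm, of g x i] that inv[of g] by (simp add: ops conjugate_def D0)
    show "x * y * inverse x * inverse y \<in> D (Suc i)" if xy: "x \<in> D i" "y \<in> D i" for i x y
    proof -
      have "x * y * inverse x * inverse y \<in> derived_set \<Gamma> (D i)"
        using xy inv[of x] inv[of y] D_sub[of i] by (force simp: ops D0)
      then have "x * y * inverse x * inverse y \<in> derived \<Gamma> (D i)"
        unfolding derived_def by (rule generate.incl)
      then show ?thesis by (simp add: D_def)
    qed
    show "D n = {1}" by fact
  qed
qed

text \<open>The derived series of the group generated by \<open>T\<close> starts outside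
  \<open>commutant {a, h}\<close> and ends in \<open>{1}\<close>, so it has a term \<open>B\<close>
  outside whose successor lies inside. That successor contains the commutators of \<open>B\<close>;
  once \<open>commutant B = commutant {a, h}\<close> is known, \<open>B\<close> has class two and is
  not abelian.\<close>

lemma class_two_subgroup_exists:
  fixes a h :: "'a::division_ring"
  assumes M: "subgroup M mult_group" "locally_solvable (mult_group\<lparr>carrier := M\<rparr>)"
    and ah: "a * h \<noteq> h * a" and T: "finite T" "T \<subseteq> M" "T \<subseteq> commutant (commutant {a, h})"
    and "{a, h, a + 1, h + 1, a + h, a + h + 1} \<subseteq> T"
  obtains B b c where "class_two B" "commutant B = commutant {a, h}" "\<And>y. y \<in> T \<Longrightarrow> normalizes y B"
    "\<And>Q. division_subring Q \<Longrightarrow> T \<subseteq> Q \<Longrightarrow> B \<subseteq> Q" "b \<in> B" "c \<in> B" "b * c \<noteq> c * b"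
proof -
  obtain D n where D: "T \<subseteq> D 0"
    "\<And>Q. division_subring Q \<Longrightarrow> T \<subseteq> Q \<Longrightarrow> D 0 \<subseteq> Q"
    "\<And>i. D i \<subseteq> D 0" "\<And>i. 1 \<in> D i" "\<And>i. 0 \<notin> D i" "\<And>i x y. x \<in> D i \<Longrightarrow> y \<in> D i \<Longrightarrow> x * y \<in> D i"
    "\<And>i x. x \<in> D i \<Longrightarrow> inverse x \<in> D i"
    "\<And>i x g. g \<in> D 0 \<Longrightarrow> x \<in> D i \<Longrightarrow> conjugate g x \<in> D i"
    "\<And>i x y. x \<in> D i \<Longrightarrow> y \<in> D i \<Longrightarrow> x * y * inverse x * inverse y \<in> D (Suc i)"
    "D n = {1}"
    by (rule derived_series[OF M T(1,2)]) (rule that)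
  let ?C = "commutant {a, h}"
  have "a \<notin> ?C" using ah by (auto simp: commutant_iff)
  then have "\<not> D 0 \<subseteq> ?C" using D(1) assms(7) by auto
  moreover have "D n \<subseteq> ?C" using D(10) by (auto simp: commutant_iff)
  ultimately obtain i where i: "\<not> D i \<subseteq> ?C" "D (Suc i) \<subseteq> ?C"
    using inc_induct[of 0 n "\<lambda>i. D i \<subseteq> ?C"] by blast
  define B where "B = D i"
  have norm: "normalizes y B" if "y \<in> T" for y
    using that D(1) D(5)[of 0] D(7)[of y 0] D(8)[of _ _ i] by (auto simp: normalizes_def B_def)
  have Q: "B \<subseteq> Q" if "division_subring Q" "T \<subseteq> Q" for Q
    using D(2)[OF that] D(3)[of i] by (auto simp: B_def)
  have Bcc: "B \<subseteq> commutant ?C" by (rule Q[OF division_subring_commutant T(3)])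
  have dich: "y \<in> commutant B \<or> y \<in> commutant (commutant B)" if "y \<in> T" "y + 1 \<in> T" for y
    using normalizing_element_cases[OF division_subring_commutant] norm that normalizes_commutant by blast
  have dich': "a \<in> commutant B \<or> a \<in> commutant (commutant B)" "h \<in> commutant B \<or> h \<in> commutant (commutant B)"
    "a + h \<in> commutant B \<or> a + h \<in> commutant (commutant B)"
    using dich assms(7) by auto
  have "\<not> (a \<in> commutant B \<and> h \<in> commutant B)"
  proof
    assume *: "a \<in> commutant B \<and> h \<in> commutant B"
    have "B \<subseteq> ?C" unfolding commutant_def using * by (auto simp: commutant_iff)
    then show False using i by (simp add: B_def)
  qed
  moreover have "x \<in> commutant X" if "x + y \<in> commutant X" "y \<in> commutant X" for x y :: 'a and X
    using division_subringD(7)[OF division_subring_commutant that] by simp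
  \<comment> \<open>In the mixed case, with one of \<open>a\<close>, \<open>h\<close> in
    \<open>commutant B\<close> and the other in its commutant, the position of \<open>a + h\<close>
    forces both into the same one of the two. This is why \<open>T\<close> contains
    \<open>a + h\<close> and its successor.\<close>
  ultimately have "a \<in> commutant (commutant B) \<and> h \<in> commutant (commutant B)"
    using dich' by (metis add.commute)
  then have "commutant B \<subseteq> ?C" by (auto simp: commutant_iff)
  moreover have "?C \<subseteq> commutant B"
    using commutant_antimono[OF Bcc] subset_commutant_commutant by blast
  ultimately have CB: "commutant B = ?C" by blast
  have ct: "class_two B"
  proof
    show "b * c * inverse b * inverse c \<in> commutant B" if "b \<in> B" "c \<in> B" for b c
      using D(9)[of b i c] that i(2) unfolding CB by (auto simp: B_def)
  qed (use D(4)[of i] D(5)[of i] D(6)[of _ i] D(7)[of _ i] in \<open>auto simp: B_def\<close>)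
  have "\<exists>b\<in>B. \<exists>c\<in>B. b * c \<noteq> c * b"
  proof (rule ccontr)
    assume "\<not> ?thesis"
    then have "B \<subseteq> commutant B" by (auto simp: commutant_iff)
    then show False using i CB by (simp add: B_def)
  qed
  then show ?thesis using that ct CB norm Q by blast
qed

section \<open>Hua's argument in a class-two group\<close>

context class_two begin

text \<open>Conjugating \<open>b\<close> by \<open>w + 1\<close> produces the element \<open>f = (l w + 1) (w + 1)\<^sup>-\<^sup>1\<close> of \<open>B\<close>; that \<open>b\<close>
  acts on \<open>f\<close> by a scalar is a quadratic equation for \<open>w\<close>.\<close>

lemma hua:
  assumes b: "b \<in> B" and w: "w \<in> commutant (commutant B)" "normalizes (w + 1) B"
    and l: "l \<in> Z" and wb: "w * b = l * b * w" "w * b \<noteq> b * w"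
  shows "w * w = - 1 \<and> l = - 1"
proof -
  have b0: "b \<noteq> 0" using nonzero b .
  have w1: "w + 1 \<noteq> 0" using w normalizes_nonzero by auto
  have l1: "l \<noteq> 1" "l \<noteq> 0" using wb b0 by auto
  define k where "k = inverse l"
  have k: "k \<in> Z" using l by (simp add: k_def division_subringD[OF Z_subring])
  have lk: "l * k = 1" "k * l = 1" "\<And>t. l * (k * t) = t" "\<And>t. k * (l * t) = t"
    using l1 by (simp_all add: k_def flip: mult.assoc)
  have lb: "l * b = b * l" using Z_commute_B[OF l b] .
  have wz: "w * z = z * w" "w * (z * t) = z * (w * t)" if "z \<in> Z" for z t
    using Z_commute[OF that w(1)] by (simp_all flip: mult.assoc)
  define f where "f = inverse b * conjugate (w + 1) b"
  have fB: "f \<in> B" unfolding f_def using b w normalizes_conjugate mult inv by blast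
  have "conjugate (w + 1) b * (w + 1) = (w + 1) * b"
    using conjugate_eq_iff[OF w1, of b "conjugate (w + 1) b"] by simp
  also have "\<dots> = b * (l * w + 1)" using wb(1) lb by (simp add: algebra_simps)
  finally have fw: "f * (w + 1) = l * w + 1"
    using b0 by (simp add: f_def mult.assoc) (simp flip: mult.assoc)
  have cw: "conjugate b w = k * w"
    using wb(1) b0 by (simp add: conjugate_eq_iff mult.assoc lk)
  define \<mu> where "\<mu> = weight b f"
  have \<mu>: "\<mu> \<in> Z" using weight_Z b fB by (simp add: \<mu>_def)
  have "conjugate b (f * (w + 1)) = conjugate b (l * w + 1)" using fw by simp
  then have "\<mu> * f * (k * w + 1) = w + 1"
    using b0 by (simp add: conjugate_mult conjugate_add conjugate_weight[OF fB] cw \<mu>_def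
        conjugate_Z[OF b l] lk)
  then have "\<mu> * f * (k * w + 1) * (w + 1) = (w + 1) * (w + 1)" by simp
  moreover have "(k * w + 1) * (w + 1) = (w + 1) * (k * w + 1)"
    using wz[OF k] by (simp add: algebra_simps)
  \<comment> \<open>Conjugation by \<open>b\<close> turned \<open>w\<close> into
    \<open>k * w\<close> and \<open>f\<close> into \<open>\<mu> * f\<close> in the equation
    \<open>fw\<close>; here \<open>f\<close> is eliminated.\<close>
  ultimately have main: "\<mu> * ((l * w + 1) * (k * w + 1)) = (w + 1) * (w + 1)"
    using fw by (metis mult.assoc)
  define A q where "A = 1 - \<mu>" and "q = 2 - \<mu> * (l + k)"
  have "2 = 1 + (1::'a)" by simp
  then have "2 \<in> Z" using division_subringD(2,3)[OF Z_subring] by metis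
  then have A: "A \<in> Z" "q \<in> Z"
    using \<mu> l k division_subringD[OF Z_subring] by (simp_all add: A_def q_def)
  have lz: "l * z = z * l" "l * (z * t) = z * (l * t)" if "z \<in> Z" for z t
    using Z_commute_Z[OF l that] by (simp_all flip: mult.assoc)
  have eq1: "A * (w * w) + q * w + A = 0"
    using main by (simp add: A_def q_def algebra_simps wz[OF k] wz[OF l] lk mult_2)
  \<comment> \<open>Conjugating by \<open>b\<close> once more and multiplying by
    \<open>l * l\<close> gives a second quadratic equation with the same leading term. The
    difference is linear in \<open>w\<close>, and a nonzero \<open>q\<close> would make
    \<open>w\<close> a scalar.\<close>
  then have "conjugate b (A * (w * w) + q * w + A) = 0" by (simp add: conjugate_def)
  then have "A * (k * w * (k * w)) + q * (k * w) + A = 0"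
    using b0 by (simp add: conjugate_add conjugate_mult conjugate_Z[OF b] A cw)
  then have "l * (l * (A * (k * w * (k * w)) + q * (k * w) + A)) = 0" by simp
  then have eq2: "A * (w * w) + q * (l * w) + A * (l * l) = 0"
    by (simp add: algebra_simps wz[OF k] lz[OF A(1)] lz[OF A(2)] lk)
  have "A * (w * w) + q * (l * w) + A * (l * l) - (A * (w * w) + q * w + A) = 0"
    unfolding eq1 eq2 by simp
  then have "(l - 1) * (q * w + A * (l + 1)) = 0"
    by (simp add: algebra_simps lz[OF A(1)] lz[OF A(2)])
  then have lin: "q * w + A * (l + 1) = 0" using l1 by simp
  have q0: "q = 0"
  proof (rule ccontr)
    assume "q \<noteq> 0"
    have "q * w = - (A * (l + 1))" using lin by (simp add: add_eq_0_iff2)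
    then have "inverse q * (q * w) = inverse q * (- (A * (l + 1)))" by simp
    then have "w = inverse q * (- (A * (l + 1)))" using \<open>q \<noteq> 0\<close> by (simp flip: mult.assoc)
    also have "\<dots> \<in> Z" using A l by (intro division_subringD[OF Z_subring])
    finally show False using Z_commute_B b wb(2) by blast
  qed
  have "A \<noteq> 0"
  proof
    assume "A = 0"
    then have "l * (2 - (l + k)) = 0" using q0 by (simp add: q_def A_def)
    then have "(l - 1) * (l - 1) = 0" by (simp add: algebra_simps lk mult_2_right)
    then show False using l1 by simp
  qed
  then have "l + 1 = 0" using lin q0 by simp
  moreover have "A * (w * w + 1) = 0" using eq1 q0 by (simp add: distrib_left)
  ultimately show ?thesis using \<open>A \<noteq> 0\<close> by (auto simp: add_eq_0_iff2)
qed

text \<open>If \<open>b\<close> and \<open>c\<close> did not commute, \<open>hua\<close> would make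
  them anticommuting square roots of -1. Applied to \<open>c + c\<close> it gives
  \<open>- 4 = - 1\<close>, so the characteristic is 3. Then
  \<open>(1 + b + c) * (1 - (b + c)) = 3 = 0\<close>, so one factor vanishes and \<open>c\<close>
  commutes with \<open>b\<close> after all.\<close>

lemma normalizing_successors_imp_commutative:
  assumes b: "b \<in> B" and c: "c \<in> B"
    and norm: "normalizes (b + 1) B" "normalizes (c + 1) B" "normalizes (c + c + 1) B"
  shows "b * c = c * b"
proof (rule ccontr)
  assume bc: "b * c \<noteq> c * b"
  have cc: "b \<in> commutant (commutant B)" "c \<in> commutant (commutant B)" "c + c \<in> commutant (commutant B)"
    using b c B_subset division_subringD(3)[OF division_subring_commutant] by blast+
  have eq: "x * y = weight x y * y * x" if "x \<in> B" "y \<in> B" for x y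
    using conjugate_eq_iff[of x y "weight x y * y"] that nonzero conjugate_weight by simp
  have c2: "c * c = - 1" and l: "weight c b = - 1"
    using hua[OF b cc(2) norm(2) weight_Z[OF c b] eq[OF c b]] bc by auto
  have b2: "b * b = - 1"
    using hua[OF c cc(1) norm(1) weight_Z[OF b c] eq[OF b c]] bc by auto
  have cb: "c * b = - (b * c)" using eq[OF c b] l by simp
  have "(c + c) * (c + c) = - 1"
  proof (rule conjunct1[OF hua[OF b cc(3) norm(3) weight_Z[OF c b]]])
    show "(c + c) * b = weight c b * b * (c + c)" using cb l by (simp add: algebra_simps)
    \<comment> \<open>Otherwise the characteristic would be 2, where anticommuting elements
      commute.\<close>
    show "(c + c) * b \<noteq> b * (c + c)"
    proof
      assume "(c + c) * b = b * (c + c)"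
      then have "2 * (c * b - b * c) = 0" by (simp only: mult_2) (simp add: algebra_simps)
      then have "(2::'a) = 0" using bc by simp
      then have "b * c + b * c = 0" by (metis mult_2 mult_zero_left)
      then have "- (b * c) = b * c" by (simp add: add_eq_0_iff2)
      then show False using cb bc by simp
    qed
  qed
  then have "(3::'a) + 1 = 0 + 1" using c2 by (simp add: algebra_simps)
  then have "(3::'a) = 0" by (rule add_right_imp_eq)
  have "(1 + b + c) * (1 - (b + c)) = 1 - (b * b + c * c + (b * c + c * b))"
    by (simp add: algebra_simps)
  also have "\<dots> = 3" using c2 b2 cb by simp
  finally have "1 + b + c = 0 \<or> 1 - (b + c) = 0" using \<open>3 = 0\<close> by simp
  moreover have "c = - (1 + b)" if "1 + b + c = 0" using that by (simp only: add_eq_0_iff)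
  moreover have "c = 1 - b" if "1 - (b + c) = 0" using that by (simp add: algebra_simps)
  moreover have "b * - (1 + b) = - (1 + b) * b" "b * (1 - b) = (1 - b) * b"
    by (simp_all add: algebra_simps)
  ultimately show False using bc by metis
qed

end

text \<open>The number \<open>4 ^ 8\<close> counts the colours for \<open>a\<close> and \<open>h\<close> together: 16 for each of \<open>a\<close>, \<open>- (a + 1)\<close>,
  \<open>h\<close> and \<open>- (h + 1)\<close>.\<close>

definition exponent_bound :: nat where
  "exponent_bound = fact (4 ^ 8) * fact (4 ^ 8)"

lemma exponent_bound_pos: "exponent_bound > 0"
  unfolding exponent_bound_def by (intro mult_pos_pos fact_gt_zero)

text \<open>Elements of \<open>B\<close> with equal colours for both \<open>a\<close> and
  \<open>h\<close> have a quotient commuting with \<open>a\<close> and \<open>h\<close>, hence with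
  \<open>B\<close> by \<open>CB\<close>. So \<open>bounded_exponent\<close> applies with
  \<open>4 ^ 8\<close> colours, whatever \<open>B\<close> is.\<close>

lemma (in class_two) power_exponent_bound_in_commutant:
  assumes norm: "normalizes a B" "normalizes (a + 1) B" "normalizes h B" "normalizes (h + 1) B"
    and CB: "commutant B = commutant {a, h}" and ah: "a * h \<noteq> h * a"
    and y: "normalizes y B" "y \<in> commutant (commutant B)"
  shows "y ^ exponent_bound \<in> commutant B"
proof -
  have "a \<notin> commutant B" "h \<notin> commutant B" using ah unfolding CB commutant_iff by auto
  define S1 where "S1 = ({..<4::nat} \<times> {..<4::nat}) \<times> ({..<4::nat} \<times> {..<4::nat})"
  obtain f :: "'a \<Rightarrow> (nat \<times> nat) \<times> (nat \<times> nat)" where f: "f ` B \<subseteq> S1"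
    "\<And>d d'. d \<in> B \<Longrightarrow> d' \<in> B \<Longrightarrow> f d = f d' \<Longrightarrow> inverse d * d' * a = a * (inverse d * d')"
    by (rule commuting_quotient_colouring[OF norm(1,2) \<open>a \<notin> commutant B\<close>, folded S1_def]) (rule that)
  obtain g :: "'a \<Rightarrow> (nat \<times> nat) \<times> (nat \<times> nat)" where g: "g ` B \<subseteq> S1"
    "\<And>d d'. d \<in> B \<Longrightarrow> d' \<in> B \<Longrightarrow> g d = g d' \<Longrightarrow> inverse d * d' * h = h * (inverse d * d')"
    by (rule commuting_quotient_colouring[OF norm(3,4) \<open>h \<notin> commutant B\<close>, folded S1_def]) (rule that)
  have S: "finite (S1 \<times> S1)" "card (S1 \<times> S1) = 4 ^ 8"
    by (simp_all add: S1_def card_cartesian_product)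
  have "y ^ (fact (card (S1 \<times> S1)) * fact (card (S1 \<times> S1))) \<in> commutant B"
  proof (rule bounded_exponent[OF S(1) _ _ y, of "\<lambda>d. (f d, g d)"])
    show "(\<lambda>d. (f d, g d)) ` B \<subseteq> S1 \<times> S1" using f(1) g(1) by auto
    fix d d' assume d: "d \<in> B" "d' \<in> B" "(f d, g d) = (f d', g d')"
    then have "inverse d * d' * a = a * (inverse d * d')" "inverse d * d' * h = h * (inverse d * d')"
      using f(2) g(2) by simp_all
    then show "inverse d * d' \<in> commutant B" unfolding CB by (simp add: commutant_iff)
  qed
  then show ?thesis unfolding S(2) exponent_bound_def .
qed

section \<open>Skew-commuting pairs: the case of infinitely many central scalars\<close>

lemma noncommuting_nonzero:
  fixes a h :: "'a::division_ring"
  assumes "a * h \<noteq> h * a"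
  shows "a \<noteq> 0" "h \<noteq> 0" "a + 1 \<noteq> 0" "h + 1 \<noteq> 0" "a + h \<noteq> 0" "a + h + 1 \<noteq> 0"
proof -
  have "x \<noteq> 0" if "x * y \<noteq> y * x" for x y :: 'a using that by auto
  from this[of a h] this[of h a] this[of "a + 1" h] this[of "h + 1" a] this[of "a + h" h] this[of "a + h + 1" h]
  show "a \<noteq> 0" "h \<noteq> 0" "a + 1 \<noteq> 0" "h + 1 \<noteq> 0" "a + h \<noteq> 0" "a + h + 1 \<noteq> 0"
    using assms by (auto simp: algebra_simps)
qed

lemma commuting_quotient_power:
  assumes "x * y = y * x" "y \<noteq> (0::'a::division_ring)" "x ^ n = y ^ n"
  shows "(x * inverse y) ^ n = 1"
proof -
  have "x * inverse y = inverse y * x" using assms mult_commute_imp_mult_inverse_commute[of y x] by simp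
  then have "(x * inverse y) ^ m = x ^ m * inverse y ^ m" for m
  proof (induction m)
    case (Suc m)
    have "(x * inverse y) ^ Suc m = x * (inverse y * x ^ m) * inverse y ^ m"
      using Suc.IH[OF Suc.prems] by (simp add: mult.assoc)
    also have "inverse y * x ^ m = x ^ m * inverse y"
      using commuting_power[OF Suc.prems, of m] by simp
    finally show ?case by (simp add: mult.assoc)
  qed simp
  then have "(x * inverse y) ^ n = y ^ n * inverse y ^ n" using assms by simp
  also have "\<dots> = 1" using assms by (simp add: power_inverse)
  finally show ?thesis .
qed

text \<open>Conjugation by \<open>h\<close> sends \<open>a + z\<close> to \<open>l * a + z\<close>
  and fixes the power of \<open>a + z\<close> with exponent \<open>exponent_bound\<close>. Hence the
  quotient \<open>q z\<close> of these two elements is a root of unity of that order. All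
  \<open>q z\<close> lie in one field and are distinct for distinct \<open>z\<close>, which limits
  the number of scalars \<open>z\<close>.\<close>

lemma skew_commuting_pair_center_finite:
  fixes a h l :: "'a::division_ring"
  assumes M: "subgroup M mult_group" "locally_solvable (mult_group\<lparr>carrier := M\<rparr>)"
    and E: "division_subring E" "E - {0} \<subseteq> M" and aE: "a \<in> E" "h \<in> E"
    and l: "h * a = l * a * h" "l \<in> commutant {a, h}" and ah: "a * h \<noteq> h * a"
  shows "finite (E \<inter> (commutant {a, h} \<inter> commutant (commutant {a, h})))"
proof (rule ccontr)
  let ?C = "commutant {a, h}" let ?N = exponent_bound
  assume "infinite (E \<inter> (?C \<inter> commutant ?C))"
  then obtain W where W: "finite W" "card W = Suc ?N" "W \<subseteq> E \<inter> (?C \<inter> commutant ?C)"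
    using infinite_arbitrarily_large by blast
  \<comment> \<open>\<open>T\<close> grows with the \<open>?N + 1\<close> chosen scalars; this is
    legitimate because \<open>exponent_bound\<close> does not depend on \<open>T\<close>.\<close>
  define T where "T = {a, h, a + 1, h + 1, a + h, a + h + 1} \<union> (\<lambda>z. a + z) ` W"
  have nz: "a + z \<noteq> 0" if "z \<in> ?C" for z
  proof
    assume "a + z = 0"
    then have "a = - z" by (simp add: add_eq_0_iff2)
    then show False using ah that by (simp add: commutant_iff)
  qed
  note nonzero6 = noncommuting_nonzero[OF ah]
  have "h \<noteq> 0" using nonzero6 by simp
  have "0 \<in> ?C" by (simp add: commutant_iff)
  have "0 \<notin> T" using nonzero6 nz W(3) by (force simp: T_def)
  moreover have TE: "T \<subseteq> E" using aE W(3) division_subringD[OF E(1)] by (auto simp: T_def)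
  ultimately have "T \<subseteq> M" using E(2) by blast
  have acc: "a \<in> commutant ?C" "h \<in> commutant ?C" using subset_commutant_commutant[of "{a, h}"] by auto
  have Tcc: "T \<subseteq> commutant ?C"
    using acc W(3) division_subringD[OF division_subring_commutant[of ?C]] by (auto simp: T_def)
  have "finite T" using W by (simp add: T_def)
  obtain B b c where B: "class_two B" "commutant B = ?C" "\<And>y. y \<in> T \<Longrightarrow> normalizes y B"
    by (rule class_two_subgroup_exists[OF M ah \<open>finite T\<close> \<open>T \<subseteq> M\<close> Tcc]) (auto simp: T_def intro: that)
  interpret class_two B by fact
  have pow: "y ^ ?N \<in> ?C" if "y \<in> T" for y
  proof -
    have "a \<in> T" "a + 1 \<in> T" "h \<in> T" "h + 1 \<in> T" by (auto simp: T_def)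
    then show ?thesis
      using power_exponent_bound_in_commutant[OF B(3) B(3) B(3) B(3) B(2) ah B(3)[OF that]] Tcc that
      unfolding B(2) by blast
  qed
  \<comment> \<open>The double centralizer of this commuting set is a field containing every
    \<open>q z\<close>; counting roots requires that they commute.\<close>
  define Y where "Y = insert a (insert l W)"
  have WC: "z * a = a * z" "z * h = h * z" "z * x = x * z" if "z \<in> W" "x \<in> ?C" for z x
    using W(3) that by (auto simp: commutant_iff)
  have Ycomm: "x * y = y * x" if "x \<in> Y" "y \<in> Y" for x y
    using that l(2) WC[of _ l] WC(3) W(3) unfolding Y_def by (auto simp: commutant_iff[of l])
  have Ycc: "Y \<subseteq> commutant (commutant Y)" by (rule subset_commutant_commutant)
  have YY: "u * v = v * u" if "u \<in> commutant (commutant Y)" "v \<in> commutant (commutant Y)" for u v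
    by (rule commutant_commutant_commute[OF Ycomm that])
  define q where "q z = (l * a + z) * inverse (a + z)" for z
  have qcc: "q z \<in> commutant (commutant Y)" if "z \<in> W" for z
    unfolding q_def using that Ycc
    by (intro division_subringD[OF division_subring_commutant]) (auto simp: Y_def)
  have roots: "q z ^ ?N = 1" if z: "z \<in> W" for z
    unfolding q_def
  proof (rule commuting_quotient_power)
    have "l * a + z \<in> commutant (commutant Y)" "a + z \<in> commutant (commutant Y)"
      using z Ycc by (auto simp: Y_def intro!: division_subringD[OF division_subring_commutant])
    then show "(l * a + z) * (a + z) = (a + z) * (l * a + z)"
      by (rule YY)
    show "a + z \<noteq> 0" using nz z W(3) by blast
    have "conjugate h (a + z) = l * a + z"
      using l(1) WC(2)[OF z, of 0] \<open>h \<noteq> 0\<close> \<open>0 \<in> ?C\<close> by (simp add: conjugate_eq_iff algebra_simps)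
    moreover have "conjugate h ((a + z) ^ ?N) = (a + z) ^ ?N"
      using pow[of "a + z"] z \<open>h \<noteq> 0\<close> by (simp add: conjugate_eq_self_iff commutant_iff T_def)
    ultimately show "(l * a + z) ^ ?N = (a + z) ^ ?N"
      using \<open>h \<noteq> 0\<close> by (simp add: conjugate_power)
  qed
  \<comment> \<open>The coefficients are those of \<open>X ^ ?N - 1\<close>; its two nonzero ones
    stand at different places because \<open>exponent_bound\<close> is positive.\<close>
  have "finite (q ` W) \<and> card (q ` W) \<le> ?N"
  proof (rule commuting_roots_finite[of _ "\<lambda>i. if i = ?N then 1 else if i = 0 then - 1 else 0"])
    show "s * t = t * s" if "s \<in> q ` W" "t \<in> q ` W" for s t
      using that qcc YY by blast
    show "(\<Sum>i\<le>?N. (if i = ?N then 1 else if i = 0 then - 1 else 0) * s ^ i) = 0" if "s \<in> q ` W" for s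
    proof -
      have "(\<Sum>i\<le>?N. (if i = ?N then 1 else if i = 0 then - 1 else 0) * s ^ i)
          = (\<Sum>i\<le>?N. (if i = ?N then s ^ ?N else 0) + (if i = 0 then - 1 else 0))"
        using exponent_bound_pos by (intro sum.cong) auto
      also have "\<dots> = s ^ ?N - 1" by (simp add: sum.distrib)
      finally show ?thesis using that roots by auto
    qed
  qed (auto simp: commutant_iff)
  then have "card (q ` W) < card W" using W(2) by simp
  then obtain z z' where z: "z \<in> W" "z' \<in> W" "z \<noteq> z'" "q z = q z'"
    using pigeonhole[of q W] by (auto simp: inj_on_def)
  have "l * a + x = q x * (a + x)" if "x \<in> W" for x
    using nz[of x] that W(3) by (auto simp: q_def mult.assoc)
  from this[of z] this[of z'] have *: "l * a + z = q z * (a + z)" "l * a + z' = q z * (a + z')"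
    using z by auto
  then have "(l * a + z) - (l * a + z') = q z * (a + z) - q z * (a + z')" by simp
  then have "(q z - 1) * (z - z') = 0" by (simp add: algebra_simps)
  then have "q z = 1" using z by simp
  then have "l * a = a" using * by simp
  then show False using l(1) ah by simp
qed

section \<open>Skew-commuting pairs: the case of finitely many central scalars\<close>

inductive_set additive_closure :: "'a::monoid_add set \<Rightarrow> 'a set" for P where
  zero: "0 \<in> additive_closure P"
| add: "p \<in> P \<Longrightarrow> x \<in> additive_closure P \<Longrightarrow> p + x \<in> additive_closure P"

lemma additive_closure_add:
  assumes "x \<in> additive_closure P" "y \<in> additive_closure P"
  shows "x + y \<in> additive_closure P"
  using assms by (induction x rule: additive_closure.induct) (auto simp: add.assoc intro: additive_closure.intros)

lemma additive_closure_incl: "P \<subseteq> additive_closure P"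
  using additive_closure.add[OF _ additive_closure.zero] by fastforce

lemma additive_closure_mult:
  fixes P :: "'a::ring_1 set"
  assumes P: "\<And>p q. p \<in> P \<Longrightarrow> q \<in> P \<Longrightarrow> p * q \<in> P"
    and "x \<in> additive_closure P" "y \<in> additive_closure P"
  shows "x * y \<in> additive_closure P"
  using assms(2)
proof (induction x rule: additive_closure.induct)
  case (add p x)
  have "p * y \<in> additive_closure P"
    using assms(3)
    by (induction y rule: additive_closure.induct) (auto simp: distrib_left P add.hyps intro: additive_closure.intros)
  then show ?case using add.IH by (simp add: distrib_right additive_closure_add)
qed (auto intro: additive_closure.intros)

text \<open>The multiplicity of each \<open>p\<close> in a sum can be counted inside the finite
  \<open>F\<close>: adding \<open>p\<close> once more replaces \<open>c p\<close> by
  \<open>c p + 1\<close>.\<close>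

lemma finite_additive_closure:
  fixes F P :: "'a::division_ring set"
  assumes F: "division_subring F" "finite F" and P: "finite P"
  shows "finite (additive_closure P)"
proof -
  define g where "g c = (\<Sum>p\<in>P. c p * p)" for c :: "'a \<Rightarrow> 'a"
  have "additive_closure P \<subseteq> g ` (P \<rightarrow>\<^sub>E F)"
  proof
    fix x assume "x \<in> additive_closure P"
    then show "x \<in> g ` (P \<rightarrow>\<^sub>E F)"
    proof (induction rule: additive_closure.induct)
      case zero
      have "0 = g (\<lambda>p\<in>P. 0)" by (simp add: g_def)
      moreover have "(\<lambda>p\<in>P. 0) \<in> P \<rightarrow>\<^sub>E F" using division_subringD(1)[OF F(1)] by simp
      ultimately show ?case by (rule image_eqI)
    next
      case (add p x)
      then obtain c where c: "c \<in> P \<rightarrow>\<^sub>E F" "x = g c" by blast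
      have "g (c(p := c p + 1)) = (\<Sum>q\<in>P. c q * q + (if q = p then p else 0))"
        unfolding g_def by (intro sum.cong) (auto simp: distrib_right)
      also have "\<dots> = p + x" using P add.hyps c by (simp add: sum.distrib g_def)
      finally have "p + x = g (c(p := c p + 1))" ..
      moreover have "c(p := c p + 1) \<in> P \<rightarrow>\<^sub>E F"
        using c add.hyps division_subringD(2,3)[OF F(1)] by (auto simp: PiE_iff extensional_def)
      ultimately show ?case by blast
    qed
  qed
  moreover have "finite (P \<rightarrow>\<^sub>E F)" using P F by (intro finite_PiE) auto
  ultimately show ?thesis using finite_surj by blast
qed

lemma finite_powers:
  assumes "finite K" "\<And>n. x ^ n \<in> K" "x \<noteq> (0::'a::division_ring)"
  obtains k where "k > 0" "x ^ k = 1"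
proof -
  have "\<not> inj (\<lambda>n::nat. x ^ n)"
    using finite_subset[of "range (\<lambda>n. x ^ n)" K] assms finite_imageD[of "\<lambda>n. x ^ n" UNIV] by auto
  then obtain i j where "i \<noteq> j" "x ^ i = x ^ j" by (auto simp: inj_on_def)
  then obtain i j where ij: "i < j" "x ^ i = x ^ j" by (metis linorder_neqE_nat)
  have "x ^ i * x ^ (j - i) = x ^ j" using ij(1) by (simp flip: power_add)
  then have "x ^ i * x ^ (j - i) = x ^ i * 1" using ij(2) by simp
  then have "x ^ i * (x ^ (j - i) - 1) = 0" by (simp add: right_diff_distrib)
  then have "x ^ (j - i) = 1" using assms(3) by simp
  then show ?thesis using that[of "j - i"] ij by simp
qed

lemma finite_subring_division_subring:
  fixes R :: "'a::division_ring set"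
  assumes "finite R" "0 \<in> R" "1 \<in> R" "- 1 \<in> R" "\<And>x y. x \<in> R \<Longrightarrow> y \<in> R \<Longrightarrow> x + y \<in> R"
    "\<And>x y. x \<in> R \<Longrightarrow> y \<in> R \<Longrightarrow> x * y \<in> R"
  shows "division_subring R"
proof -
  have "inverse x \<in> R" if x: "x \<in> R" for x
  proof (cases "x = 0")
    case False
    have pow: "x ^ n \<in> R" for n using x assms by (induction n) auto
    obtain k where k: "k > 0" "x ^ k = 1" using finite_powers[OF assms(1) pow False] .
    then have "x * x ^ (k - 1) = 1" by (metis Suc_pred' power_Suc)
    then have "inverse x = x ^ (k - 1)" using inverse_unique by blast
    then show ?thesis using pow by simp
  qed (use assms in simp)
  moreover have "- x \<in> R" if "x \<in> R" for x using assms(6)[OF assms(4) that] by simp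
  ultimately show ?thesis using assms by (simp add: division_subring_def)
qed

lemma skew_commuting_power:
  fixes a h l :: "'a::division_ring"
  assumes "h * a = l * a * h" "l * a = a * l" "l * h = h * l"
  shows "h ^ j * a ^ i = l ^ (i * j) * a ^ i * h ^ j"
proof -
  have la: "l ^ n * a ^ m = a ^ m * l ^ n" and lh: "l ^ n * h ^ m = h ^ m * l ^ n" for n m
    using commuting_power[of l] commuting_power[of a] commuting_power[of h] assms by metis+
  have 1: "h * a ^ i = l ^ i * a ^ i * h" for i
  proof (induction i)
    case (Suc i)
    have "h * a ^ Suc i = l ^ i * a ^ i * (h * a)" using Suc by (simp add: mult.assoc power_Suc2 del: power_Suc) (simp flip: mult.assoc)
    also have "\<dots> = l ^ i * (a ^ i * l ^ 1) * a * h" using assms(1) by (simp add: mult.assoc)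
    also have "\<dots> = l ^ Suc i * a ^ Suc i * h"
      unfolding la[of 1 i, symmetric] by (simp add: mult.assoc power_Suc2 del: power_Suc)
    finally show ?case .
  qed simp
  show ?thesis
  proof (induction j)
    case (Suc j)
    have "h ^ Suc j * a ^ i = h ^ 1 * l ^ (i * j) * (a ^ i * h ^ j)" using Suc by (simp add: mult.assoc)
    also have "\<dots> = l ^ (i * j) * (h * a ^ i) * h ^ j" using lh[of "i * j" 1] by (simp add: mult.assoc) (simp flip: mult.assoc)
    also have "\<dots> = l ^ (i * j + i) * a ^ i * h ^ Suc j" by (simp add: 1 mult.assoc power_add)
    finally show ?case by (simp add: add.commute)
  qed simp
qed

text \<open>If the field \<open>F\<close> of scalars is finite, \<open>l\<close> has a finite order
  \<open>k\<close>, so \<open>a ^ k\<close> and \<open>h ^ k\<close> lie in \<open>F\<close>, and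
  the sums of monomials \<open>z * a ^ i * h ^ j\<close> form a finite division ring
  \<open>R\<close>. With \<open>T = R - {0}\<close> the group \<open>B\<close> lies in
  \<open>R\<close> and is normalized by all nonzero elements of \<open>R\<close>, in particular by
  successors of its own elements, so \<open>normalizing_successors_imp_commutative\<close>
  applies.\<close>

lemma skew_commuting_pair_center_infinite:
  fixes a h l :: "'a::division_ring"
  assumes M: "subgroup M mult_group" "locally_solvable (mult_group\<lparr>carrier := M\<rparr>)"
    and E: "division_subring E" "E - {0} \<subseteq> M" and aE: "a \<in> E" "h \<in> E"
    and l: "h * a = l * a * h" "l \<in> commutant {a, h}" and ah: "a * h \<noteq> h * a"
  shows "infinite (E \<inter> (commutant {a, h} \<inter> commutant (commutant {a, h})))"
proof
  let ?C = "commutant {a, h}"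
  define F where "F = E \<inter> (?C \<inter> commutant ?C)"
  assume "finite (E \<inter> (commutant {a, h} \<inter> commutant (commutant {a, h})))"
  then have fin: "finite F" by (simp add: F_def)
  have F: "division_subring F"
    unfolding F_def by (intro division_subring_Int E division_subring_commutant)
  note FD = division_subringD[OF F] and ED = division_subringD[OF E(1)]
    and CD = division_subringD[OF division_subring_commutant[of ?C]]
  have acc: "a \<in> commutant ?C" "h \<in> commutant ?C" using subset_commutant_commutant[of "{a, h}"] by auto
  have nz: "a \<noteq> 0" "h \<noteq> 0" using ah by auto
  have "l = h * a * inverse h * inverse a" using l(1) nz by (simp add: mult.assoc)
  then have lF: "l \<in> F" using l(2) aE acc ED CD by (simp add: F_def)
  have "l \<noteq> 0" using l nz by auto
  obtain k where k: "k > 0" "l ^ k = 1"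
    using finite_powers[OF fin FD(8)[OF lF] \<open>l \<noteq> 0\<close>] .
  have comm: "l * a = a * l" "l * h = h * l" using l(2) by (simp_all add: commutant_iff)
  note sk = skew_commuting_power[OF l(1) comm]
  have "h ^ 1 * a ^ k = a ^ k * h ^ 1" using sk[of 1 k] k by simp
  moreover have "h ^ k * a ^ 1 = a ^ 1 * h ^ k" using sk[of k 1] k by simp
  ultimately have akF: "a ^ k \<in> F" "h ^ k \<in> F"
    using aE acc ED CD by (auto simp: F_def commutant_iff power_commutes)
  define P where "P = {z * a ^ i * h ^ j |z i j. z \<in> F}"
  have PI: "z * a ^ i * h ^ j \<in> P" if "z \<in> F" for z i j using that by (auto simp: P_def)
  have FC: "z * a = a * z" "z * h = h * z" if "z \<in> F" for z using that by (auto simp: F_def commutant_iff)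
  have FC': "a ^ i * z = z * a ^ i" "h ^ i * z = z * h ^ i" if "z \<in> F" for z i
    using FC[OF that] commuting_power by metis+
  \<comment> \<open>Exponents are reduced modulo \<open>k\<close>, and the surplus powers of
    \<open>a ^ k\<close> and \<open>h ^ k\<close> are absorbed into the coefficient.\<close>
  have "P \<subseteq> (\<lambda>(z, i, j). z * a ^ i * h ^ j) ` (F \<times> {..<k} \<times> {..<k})"
  proof
    fix x assume "x \<in> P"
    then obtain z i j where x: "x = z * a ^ i * h ^ j" "z \<in> F" by (auto simp: P_def)
    have red: "y ^ n = (y ^ k) ^ (n div k) * y ^ (n mod k)" for y :: 'a and n
      by (simp flip: power_mult power_add)
    have hF: "(h ^ k) ^ (j div k) \<in> F" "(a ^ k) ^ (i div k) \<in> F" using akF FD by auto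
    have "x = z * ((a ^ k) ^ (i div k) * a ^ (i mod k)) * ((h ^ k) ^ (j div k) * h ^ (j mod k))"
      unfolding x(1) by (intro arg_cong2[where f = "(*)"] refl red)
    also have "\<dots> = z * ((a ^ k) ^ (i div k) * (a ^ (i mod k) * (h ^ k) ^ (j div k))) * h ^ (j mod k)"
      by (simp only: mult.assoc)
    also have "\<dots> = (z * (a ^ k) ^ (i div k) * (h ^ k) ^ (j div k)) * a ^ (i mod k) * h ^ (j mod k)"
      unfolding FC'(1)[OF hF(1)] by (simp only: mult.assoc)
    finally show "x \<in> (\<lambda>(z, i, j). z * a ^ i * h ^ j) ` (F \<times> {..<k} \<times> {..<k})"
      using x(2) hF FD(4) k
      by (intro image_eqI[of _ _ "(z * (a ^ k) ^ (i div k) * (h ^ k) ^ (j div k), i mod k, j mod k)"]) simp_all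
  qed
  then have "finite P" using fin finite_subset by blast
  have Pmult: "p * q \<in> P" if P: "p \<in> P" "q \<in> P" for p q
  proof -
    obtain z i j z' i' j' where pq: "p = z * a ^ i * h ^ j" "z \<in> F" "q = z' * a ^ i' * h ^ j'" "z' \<in> F"
      using P by (auto simp: P_def)
    have lF': "l ^ n \<in> F" for n using FD lF by auto
    have "p * q = z * (a ^ i * (h ^ j * z')) * a ^ i' * h ^ j'" using pq by (simp add: mult.assoc)
    also have "\<dots> = z * (a ^ i * z') * (h ^ j * a ^ i') * h ^ j'"
      unfolding FC'(2)[OF pq(4)] by (simp only: mult.assoc)
    also have "\<dots> = z * z' * (a ^ i * (h ^ j * a ^ i')) * h ^ j'"
      unfolding FC'(1)[OF pq(4)] by (simp only: mult.assoc)
    also have "\<dots> = z * z' * (a ^ i * l ^ (i' * j)) * a ^ i' * h ^ j * h ^ j'"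
      unfolding sk by (simp only: mult.assoc)
    also have "\<dots> = (z * z' * l ^ (i' * j)) * a ^ (i + i') * h ^ (j + j')"
      unfolding FC'(1)[OF lF'] by (simp only: mult.assoc power_add)
    finally show ?thesis using pq lF' FD by (simp add: PI)
  qed
  define R where "R = additive_closure P"
  have FR: "z \<in> R" if "z \<in> F" for z
    using PI[OF that, of 0 0] additive_closure_incl by (auto simp: R_def)
  have aR: "a \<in> R" "h \<in> R"
    using PI[OF FD(2), of 1 0] PI[OF FD(2), of 0 1] additive_closure_incl[of P] by (auto simp: R_def)
  have R: "division_subring R"
  proof (rule finite_subring_division_subring)
    show "finite R" unfolding R_def by (rule finite_additive_closure[OF F fin \<open>finite P\<close>])
    show "0 \<in> R" "1 \<in> R" "- 1 \<in> R" using FR FD(1,2,5) by auto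
    show "x + y \<in> R" if "x \<in> R" "y \<in> R" for x y using that additive_closure_add by (auto simp: R_def)
    show "x * y \<in> R" if "x \<in> R" "y \<in> R" for x y
      using that additive_closure_mult[OF Pmult] by (auto simp: R_def)
  qed
  have Rsub: "R \<subseteq> Q" if Q: "division_subring Q" "F \<subseteq> Q" "a \<in> Q" "h \<in> Q" for Q
  proof
    fix x assume "x \<in> R"
    then have "x \<in> additive_closure P" by (simp add: R_def)
    then show "x \<in> Q"
      by (induction rule: additive_closure.induct)
         (use Q division_subringD[OF Q(1)] in \<open>auto simp: P_def\<close>)
  qed
  note RD = division_subringD[OF R]
  define T where "T = R - {0}"
  have "finite T" unfolding T_def R_def using finite_additive_closure[OF F fin \<open>finite P\<close>] by simp
  have "T \<subseteq> M" using Rsub[OF E(1)] aE E(2) by (auto simp: T_def F_def)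
  have Tcc: "T \<subseteq> commutant ?C"
    using Rsub[OF division_subring_commutant[of ?C]] acc by (auto simp: T_def F_def)
  have T6: "{a, h, a + 1, h + 1, a + h, a + h + 1} \<subseteq> T"
    using aR RD noncommuting_nonzero[OF ah] by (auto simp: T_def)
  obtain B b c where B: "class_two B" "\<And>y. y \<in> T \<Longrightarrow> normalizes y B"
    "\<And>Q. division_subring Q \<Longrightarrow> T \<subseteq> Q \<Longrightarrow> B \<subseteq> Q" "b \<in> B" "c \<in> B" "b * c \<noteq> c * b"
    by (rule class_two_subgroup_exists[OF M ah \<open>finite T\<close> \<open>T \<subseteq> M\<close> Tcc T6]) (rule that)
  interpret class_two B by fact
  have bc: "b \<in> R" "c \<in> R" using B(3)[OF R] B(4,5) by (auto simp: T_def)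
  have "c + c + 1 \<noteq> 0"
  proof
    assume "c + c + 1 = 0"
    then have 2: "2 * c = - 1" by (simp add: mult_2 add_eq_0_iff2)
    then have "(2::'a) \<noteq> 0" by auto
    moreover have "2 * (c * b - b * c) = 2 * c * b - b * (2 * c)"
      by (simp only: mult_2) (simp add: algebra_simps)
    ultimately show False using 2 B(6) by simp
  qed
  then have "b + 1 \<in> T" "c + 1 \<in> T" "c + c + 1 \<in> T"
    using bc RD noncommuting_nonzero[OF B(6)] by (auto simp: T_def)
  then have "b * c = c * b"
    by (intro normalizing_successors_imp_commutative B)
  then show False using B(6) by simp
qed

text \<open>Replacing \<open>x\<close>, \<open>y\<close> by noncommuting elements of a class-two
  group makes their commutator a scalar. For such a pair the set of scalars in \<open>E\<close>
  would be both finite and infinite.\<close>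

theorem locally_solvable_division_subring_commutative:
  fixes E :: "'a::division_ring set"
  assumes M: "subgroup M mult_group" "locally_solvable (mult_group\<lparr>carrier := M\<rparr>)"
    and E: "division_subring E" "E - {0} \<subseteq> M" and x: "x \<in> E" "y \<in> E"
  shows "x * y = y * x"
proof (rule ccontr)
  assume xy: "x * y \<noteq> y * x"
  define T where "T = {x, y, x + 1, y + 1, x + y, x + y + 1}"
  have TE: "T \<subseteq> E" using x division_subringD[OF E(1)] by (auto simp: T_def)
  have "T \<subseteq> M" using TE E(2) noncommuting_nonzero[OF xy] by (auto simp: T_def)
  have "x \<in> commutant (commutant {x, y})" "y \<in> commutant (commutant {x, y})"
    using subset_commutant_commutant[of "{x, y}"] by auto
  then have Tcc: "T \<subseteq> commutant (commutant {x, y})"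
    using division_subringD[OF division_subring_commutant[of "commutant {x, y}"]] by (auto simp: T_def)
  have "finite T" "{x, y, x + 1, y + 1, x + y, x + y + 1} \<subseteq> T" by (auto simp: T_def)
  from class_two_subgroup_exists[OF M xy this(1) \<open>T \<subseteq> M\<close> Tcc this(2)]
  obtain B b c where B: "class_two B" "\<And>Q. division_subring Q \<Longrightarrow> T \<subseteq> Q \<Longrightarrow> B \<subseteq> Q"
    "b \<in> B" "c \<in> B" "b * c \<noteq> c * b" by metis
  interpret class_two B by fact
  have bcE: "b \<in> E" "c \<in> E" using B(2)[OF E(1) TE] B(3,4) by auto
  have "c * b = weight c b * b * c"
    using conjugate_eq_iff[of c b "weight c b * b"] B nonzero conjugate_weight by simp
  moreover have "weight c b \<in> commutant {b, c}"
    using weight_Z[OF B(4,3)] B(3,4) by (auto simp: Z_def commutant_iff)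
  ultimately show False
    using skew_commuting_pair_center_finite[OF M E bcE] skew_commuting_pair_center_infinite[OF M E bcE] B(5)
    by blast
qed

subsection \<open>The theorem\<close>

text \<open>As the elements commute, each new \<open>x\<close> lies in \<open>commutant X\<close>.
  Passing to its centralizer there costs only a finite dimension, because its equation has central
  coefficients.\<close>

lemma finitely_spanned_over_commutant_of_finite:
  fixes X :: "'a::division_ring set"
  assumes "finite X" and "\<And>x y. x \<in> X \<Longrightarrow> y \<in> X \<Longrightarrow> x * y = y * x"
    and "\<And>i. k i \<in> center_of" "k n \<noteq> 0" and "\<And>x. x \<in> X \<Longrightarrow> (\<Sum>i\<le>n. k i * x ^ i) = 0"
  shows "finitely_spanned (commutant X) UNIV"
  using assms(1,2,5)
proof (induction X rule: finite_induct)
  case empty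
  have "x = (\<Sum>b\<in>{1}. x * b)" for x :: 'a by simp
  then show ?case unfolding finitely_spanned_def
    by (intro exI[of _ "{1}"]) (auto simp: commutant_iff intro: exI[of _ "\<lambda>_. _"])
next
  case (insert x X)
  have eq: "commutant (insert x X) = commutant X \<inter> commutant {x}" by (auto simp: commutant_iff)
  have "finitely_spanned (commutant X \<inter> commutant {x}) (commutant X)"
  proof (rule finitely_spanned_over_commutant[of _ _ k n])
    show "x \<in> commutant X" using insert.prems(1) by (auto simp: commutant_iff)
    show "k i \<in> commutant (commutant X)" for i
      using assms(3)[of i] by (auto simp: center_of_def commutant_iff)
    show "(\<Sum>i\<le>n. k i * x ^ i) = 0" using insert.prems(2) by simp
  qed (use assms(4) division_subring_commutant in auto)
  moreover have "finitely_spanned (commutant X) UNIV" using insert.IH insert.prems by simp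
  ultimately show ?case
    unfolding eq using division_subring_Int[OF division_subring_commutant division_subring_commutant]
    by (intro finitely_spanned_trans[where K = "commutant X" and V = UNIV and L = "commutant X \<inter> commutant {x}"]) simp_all
qed

theorem theorem2p5:
  fixes M A :: "('a::division_ring) set" and \<alpha> :: 'a
  assumes noncomm: "\<exists>x y::'a. x * y \<noteq> y * x"
    and maxM: "maximal_subgroup M mult_group"
    and nonabM: "\<not> abelian_set mult_group M"
    and locsolv: "locally_solvable (mult_group\<lparr>carrier := M\<rparr>)"
    and maxA: "maximal_abelian_normal A (mult_group\<lparr>carrier := M\<rparr>)"
    and alphaA: "\<alpha> \<in> A" and alphaF: "\<alpha> \<notin> center_of"
    and alg: "algebraic_over center_of \<alpha>"
  shows "finite_dim_over (center_of :: 'a set)"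
proof -
  have M: "subgroup M mult_group" using maxM by (simp add: maximal_subgroup_def)
  note MD = subgroup_mult_groupD[OF M]
  have M0: "g \<noteq> 0" if "g \<in> M" for g using MD(1) that by auto
  interpret MG: group "mult_group\<lparr>carrier := M\<rparr>"
    by (rule group.subgroup_imp_group[OF group_mult_group M])
  have A: "A \<lhd> mult_group\<lparr>carrier := M\<rparr>" "abelian_set (mult_group\<lparr>carrier := M\<rparr>) A"
    using maxA by (auto simp: maximal_abelian_normal_def)
  have invM: "inv\<^bsub>mult_group\<lparr>carrier := M\<rparr>\<^esub> g = inverse g" if "g \<in> M" for g
    using that MD by (intro MG.inv_equality) (auto intro!: left_inverse)

  \<comment> \<open>The conjugates of \<alpha> under \<open>M\<close>\<close>
  define X where "X = (\<lambda>g. conjugate g \<alpha>) ` M"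
  have "X \<subseteq> A"
    using normal.inv_op_closed2[OF A(1) _ alphaA] invM by (auto simp: X_def conjugate_def)
  then have Xcomm: "x * y = y * x" if "x \<in> X" "y \<in> X" for x y
    using A(2) that by (auto simp: abelian_set_def)
  have "\<alpha> \<in> X" using MD(2) by (force simp: X_def)

  obtain n0 c where c: "\<And>i. i \<le> n0 \<Longrightarrow> c i \<in> center_of" "\<exists>i\<le>n0. c i \<noteq> 0" "(\<Sum>i\<le>n0. c i * \<alpha> ^ i) = 0"
    using alg unfolding algebraic_over_def by blast
  \<comment> \<open>The given coefficients may end in zeros and are arbitrary beyond
    \<open>n0\<close>. Cutting them off at the true degree \<open>n\<close> gives a nonzero leading
    coefficient and central values everywhere.\<close>
  define n where "n = Max {i. i \<le> n0 \<and> c i \<noteq> 0}"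
  have fin: "finite {i. i \<le> n0 \<and> c i \<noteq> 0}" by simp
  have n: "n \<le> n0" "c n \<noteq> 0"
    using Max_in[OF fin] c(2) by (auto simp: n_def)
  have n_max: "i \<le> n" if "i \<le> n0" "c i \<noteq> 0" for i using Max_ge[OF fin] that by (simp add: n_def)
  define k where "k i = (if i \<le> n then c i else 0)" for i
  have k: "k i \<in> center_of" "k n \<noteq> 0" for i
    using c(1)[of i] n by (auto simp: k_def center_of_def)
  have "(\<Sum>i\<le>n. k i * \<alpha> ^ i) = (\<Sum>i\<le>n0. c i * \<alpha> ^ i)"
    using n n_max by (intro sum.mono_neutral_cong_left) (auto simp: k_def)
  then have k\<alpha>: "(\<Sum>i\<le>n. k i * \<alpha> ^ i) = 0" using c by simp
  have kX: "(\<Sum>i\<le>n. k i * x ^ i) = 0" if x: "x \<in> X" for x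
  proof -
    obtain g where g: "g \<in> M" "x = conjugate g \<alpha>" using x by (auto simp: X_def)
    have "conjugate g (k i) = k i" for i
      using k(1)[of i] M0[OF g(1)] by (simp add: conjugate_eq_self_iff center_of_def)
    then have "(\<Sum>i\<le>n. k i * x ^ i) = conjugate g (\<Sum>i\<le>n. k i * \<alpha> ^ i)"
      using M0[OF g(1)] by (simp add: g(2) conjugate_sum conjugate_mult conjugate_power)
    then show ?thesis by (simp add: k\<alpha> conjugate_def)
  qed
  have "finite X"
    using commuting_roots_finite[OF Xcomm _ k(2) kX] k(1) by (auto simp: commutant_iff center_of_def)

  \<comment> \<open>The centralizer of the conjugates and its normalizer\<close>
  define E where "E = commutant X"
  have E: "division_subring E" unfolding E_def by (rule division_subring_commutant)
  define H where "H = {g. normalizes g E}"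
  have H: "subgroup H mult_group"
  proof (rule group.subgroupI[OF group_mult_group])
    show "H \<subseteq> carrier mult_group" by (auto simp: H_def normalizes_def)
    show "H \<noteq> {}" by (auto simp: H_def normalizes_def intro!: exI[of _ 1])
    show "inv\<^bsub>mult_group\<^esub> g \<in> H" if "g \<in> H" for g
      using that by (auto simp: H_def normalizes_def inv_mult_group)
    show "g \<otimes>\<^bsub>mult_group\<^esub> g' \<in> H" if "g \<in> H" "g' \<in> H" for g g'
      using that by (auto simp: H_def normalizes_def nonzero_inverse_mult_distrib
          simp flip: conjugate_conjugate)
  qed
  have "M \<subseteq> H"
  proof
    fix g assume g: "g \<in> M"
    have "conjugate g x \<in> X" if "x \<in> X" "g \<in> M" for x g
      using that MD(3) M0 by (auto simp: X_def conjugate_conjugate)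
    then have "normalizes g X" using g MD(4) M0 by (auto simp: normalizes_def)
    then show "g \<in> H" by (simp add: H_def E_def normalizes_commutant)
  qed
  \<comment> \<open>If every nonzero element normalized \<open>E\<close>, each \<open>y\<close>
    would lie in \<open>E\<close> or centralize it. Since \<alpha> belongs to both \<open>X\<close>
    and \<open>E\<close>, an element not commuting with \<alpha> does neither.\<close>
  moreover have "H \<noteq> carrier mult_group"
  proof
    assume "H = carrier mult_group"
    then have all: "normalizes y E" if "y \<noteq> 0" for y using that by (auto simp: H_def)
    have dich: "y \<in> E \<or> y \<in> commutant E" for y
    proof (cases "y = 0 \<or> y + 1 = 0")
      case True
      then have "y = 0 \<or> y = - 1" by (auto simp: add_eq_0_iff2)
      then show ?thesis using division_subringD[OF E] by auto
    qed (use normalizing_element_cases[OF E] all in auto)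
    obtain y where y: "\<alpha> * y \<noteq> y * \<alpha>" using alphaF by (auto simp: center_of_def)
    have \<alpha>E: "\<alpha> \<in> E" using \<open>\<alpha> \<in> X\<close> Xcomm by (auto simp: E_def commutant_iff)
    have "y \<notin> E" using y \<open>\<alpha> \<in> X\<close> by (auto simp: E_def commutant_iff)
    moreover have "y \<notin> commutant E" using y \<alpha>E by (auto simp: commutant_iff)
    ultimately show False using dich by blast
  qed
  ultimately have HM: "H = M" using maxM H by (auto simp: maximal_subgroup_def)
  have "E - {0} \<subseteq> M"
    unfolding HM[symmetric] H_def normalizes_def conjugate_def using division_subringD[OF E] by auto
  then have Ecomm: "x * y = y * x" if "x \<in> E" "y \<in> E" for x y
    using locally_solvable_division_subring_commutative[OF M locsolv E] that by blast

  \<comment> \<open>Finite dimension over the center\<close>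
  have span: "finitely_spanned E UNIV"
    unfolding E_def
    by (rule finitely_spanned_over_commutant_of_finite[OF \<open>finite X\<close> Xcomm k kX])
  have "finitely_spanned center_of E"
    by (rule subfield_finitely_spanned_over_center[OF E Ecomm span])
  moreover have "division_subring (center_of :: 'a set)"
    unfolding center_of_eq_commutant by (rule division_subring_commutant)
  moreover have "center_of \<subseteq> E" by (auto simp: E_def center_of_def commutant_iff)
  ultimately have "finitely_spanned center_of (UNIV :: 'a set)"
    using span by (intro finitely_spanned_trans[where K = E and V = UNIV and L = center_of]) simp_all
  then show ?thesis by (auto simp: finitely_spanned_def finite_dim_over_def)
qed

end
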